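(* There exists a Radon measure $\mu$ in $\mathbb{R}^2$ which satisfies $$\int_0^1\alpha_\mu^1(x,r)^2\,\frac{dr}{r}<\infty\quad\text{for all }x\in\operatorname{supp}\mu,$$ and such that $$\lim_{r\to0}\frac{\mu(B(x,r))}{r}=0\quad\text{for all }x\in\operatorname{supp}\mu.$$ In particular, $\mu$ is not $1$-rectifiable.
   Context: $B(x,r)$ is the open ball in $\mathbb{R}^2$ with center $x$ and radius $r$; $\mathcal{H}^1$ is $1$-dimensional Hausdorff measure. A Borel measure $\mu$ in $\mathbb{R}^2$ is called $1$-rectifiable if there are countably many Lipschitz images $\Gamma_i$ of $\mathbb{R}$ such that $\mu(\mathbb{R}^2\setminus\bigcup_i\Gamma_i)=0$, and additionally $\mu\ll\mathcal{H}^1$. For measures $\sigma,\nu$ and an open ball $B$, set $$F_B(\sigma,\nu)=\sup\Bigl\{\Bigl|\int\phi\,d\sigma-\int\phi\,d\nu\Bigr| : \phi\in \mathrm{Lip}_1(B)\Bigr\},$$ where $\mathrm{Lip}_1(B)$ is the set of functions $\phi:\mathbb{R}^2\to\mathbb{R}$ with Lipschitz constant at most $1$ and $\operatorname{supp}\phi\subset B$. For a measure $\mu$ and a ball $B=B(x,r)$ with $\mu(B)>0$, $$\alpha_\mu^1(x,r)=\frac{1}{r\,\mu(B)}\inf_{c\ge 0,\,L}F_B(\mu,c\,\mathcal{H}^1|_L),$$ where the infimum is over all $c\ge0$ and all lines $L\subset\mathbb{R}^2$. *)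

theory Defs
  imports "HOL-Analysis.Analysis"
begin

section \<open>One-dimensional Hausdorff measure\<close>

text \<open>
  The normalization is the one for which the measure of a line segment is its length.
  Boundedness of the covering sets is required because \<^const>\<open>diameter\<close> is a real number
  and has no meaningful value on unbounded sets.
\<close>

definition hausdorff1_cover :: "real \<Rightarrow> 'a::metric_space set \<Rightarrow> (nat \<Rightarrow> 'a set) set" where
  "hausdorff1_cover \<delta> A = {E. (\<forall>i. bounded (E i) \<and> diameter (E i) \<le> \<delta>) \<and> A \<subseteq> (\<Union>i. E i)}"

definition hausdorff1_pre :: "real \<Rightarrow> 'a::metric_space set \<Rightarrow> ennreal" where
  "hausdorff1_pre \<delta> A = (INF E\<in>hausdorff1_cover \<delta> A. \<Sum>i. ennreal (diameter (E i)))"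

definition hausdorff1_outer :: "'a::metric_space set \<Rightarrow> ennreal" where
  "hausdorff1_outer A = (SUP \<delta>\<in>{0<..}. hausdorff1_pre \<delta> A)"

text \<open>
  \<^const>\<open>measure_of\<close> yields the zero measure when its argument is not countably additive; lemma
  \<open>emeasure_hausdorff1\<close> below shows that this does not happen here.
\<close>

definition hausdorff1 :: "'a::metric_space measure" where
  "hausdorff1 = measure_of UNIV (sets borel) hausdorff1_outer"

lemma space_hausdorff1 [simp]: "space hausdorff1 = UNIV"
  by (simp add: hausdorff1_def)

lemma sets_hausdorff1 [simp, measurable_cong]: "sets hausdorff1 = sets borel"
  unfolding hausdorff1_def
  by (metis sets.sets_measure_of_eq space_borel)

lemma hausdorff1_pre_le:
  "E \<in> hausdorff1_cover \<delta> A \<Longrightarrow> hausdorff1_pre \<delta> A \<le> (\<Sum>i. ennreal (diameter (E i)))"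
  unfolding hausdorff1_pre_def by (rule INF_lower)

lemma hausdorff1_pre_le_outer: "\<delta> > 0 \<Longrightarrow> hausdorff1_pre \<delta> A \<le> hausdorff1_outer A"
  unfolding hausdorff1_outer_def by (rule SUP_upper) simp

lemma hausdorff1_pre_antimono: "\<delta> \<le> \<epsilon> \<Longrightarrow> hausdorff1_pre \<epsilon> A \<le> hausdorff1_pre \<delta> A"
  unfolding hausdorff1_pre_def
  by (rule INF_superset_mono) (auto simp: hausdorff1_cover_def intro: order_trans)

lemma hausdorff1_pre_mono: "A \<subseteq> B \<Longrightarrow> hausdorff1_pre \<delta> A \<le> hausdorff1_pre \<delta> B"
  unfolding hausdorff1_pre_def
  by (rule INF_superset_mono) (auto simp: hausdorff1_cover_def)

lemma hausdorff1_outer_mono: "A \<subseteq> B \<Longrightarrow> hausdorff1_outer A \<le> hausdorff1_outer B"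
  unfolding hausdorff1_outer_def by (rule SUP_mono) (auto intro: hausdorff1_pre_mono)

lemma hausdorff1_outer_empty [simp]: "hausdorff1_outer {} = 0"
proof -
  have "hausdorff1_pre \<delta> ({}::'a set) \<le> 0" if "\<delta> > 0" for \<delta>
    using hausdorff1_pre_le[of "\<lambda>_. {}" \<delta> "{}::'a set"] that
    by (auto simp: hausdorff1_cover_def diameter_def)
  then show ?thesis
    unfolding hausdorff1_outer_def by (intro antisym SUP_least) auto
qed

lemma hausdorff1_pre_UN_le:
  "hausdorff1_pre \<delta> (\<Union>n. A n) \<le> (\<Sum>n. hausdorff1_pre \<delta> (A n))"
proof (rule ennreal_le_epsilon)
  fix e :: real assume e: "0 < e" and fin: "(\<Sum>n. hausdorff1_pre \<delta> (A n)) < top"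
  then have *: "hausdorff1_pre \<delta> (A n) < hausdorff1_pre \<delta> (A n) + e * (1/2)^Suc n" for n
    by (auto simp add: less_top dest!: ennreal_suminf_lessD)
  have "\<exists>E. E \<in> hausdorff1_cover \<delta> (A n) \<and>
      (\<Sum>i. ennreal (diameter (E i))) \<le> hausdorff1_pre \<delta> (A n) + e * (1/2)^Suc n" for n
    using *[of n] unfolding hausdorff1_pre_def INF_less_iff by (auto intro: less_imp_le)
  then obtain E where E: "\<And>n. E n \<in> hausdorff1_cover \<delta> (A n)"
    and Ele: "\<And>n. (\<Sum>i. ennreal (diameter (E n i))) \<le> hausdorff1_pre \<delta> (A n) + e * (1/2)^Suc n"
    by metis
  define C where "C = case_prod E \<circ> prod_decode"
  have "(\<Union>n. A n) \<subseteq> (\<Union>i. C i)"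
  proof
    fix x assume "x \<in> (\<Union>n. A n)"
    then obtain n i where "x \<in> E n i"
      using E unfolding hausdorff1_cover_def by blast
    then have "x \<in> C (prod_encode (n, i))"
      by (simp add: C_def)
    then show "x \<in> (\<Union>i. C i)" by blast
  qed
  then have "C \<in> hausdorff1_cover \<delta> (\<Union>n. A n)"
    using E by (auto simp: hausdorff1_cover_def C_def split_def)
  then have "hausdorff1_pre \<delta> (\<Union>n. A n) \<le> (\<Sum>i. ennreal (diameter (C i)))"
    by (rule hausdorff1_pre_le)
  also have "\<dots> = (\<Sum>i. (\<lambda>(m, n). ennreal (diameter (E m n))) (prod_decode i))"
    by (simp add: C_def split_def)
  also have "\<dots> = (\<Sum>n. \<Sum>i. ennreal (diameter (E n i)))"
    using suminf_ennreal_2dimen[of "\<lambda>n. \<Sum>i. ennreal (diameter (E n i))"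
        "\<lambda>(m, n). ennreal (diameter (E m n))"] by (simp add: comp_def)
  also have "\<dots> \<le> (\<Sum>n. hausdorff1_pre \<delta> (A n) + e * (1/2) ^ Suc n)"
    by (intro suminf_le Ele) auto
  also have "\<dots> = (\<Sum>n. hausdorff1_pre \<delta> (A n)) + (\<Sum>n. ennreal e * ennreal ((1/2) ^ Suc n))"
    using \<open>0 < e\<close> by (subst suminf_add[symmetric])
                     (auto simp del: ennreal_suminf_cmult simp add: ennreal_mult[symmetric])
  also have "\<dots> = (\<Sum>n. hausdorff1_pre \<delta> (A n)) + e"
    unfolding ennreal_suminf_cmult
    by (subst suminf_ennreal_eq[OF zero_le_power power_half_series]) auto
  finally show "hausdorff1_pre \<delta> (\<Union>n. A n) \<le> (\<Sum>n. hausdorff1_pre \<delta> (A n)) + e" .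
qed

lemma hausdorff1_outer_UN_le:
  "hausdorff1_outer (\<Union>n. A n) \<le> (\<Sum>n. hausdorff1_outer (A n))"
  unfolding hausdorff1_outer_def[of "\<Union>n. A n"]
proof (rule SUP_least)
  fix \<delta> :: real assume "\<delta> \<in> {0<..}"
  then have "(\<Sum>n. hausdorff1_pre \<delta> (A n)) \<le> (\<Sum>n. hausdorff1_outer (A n))"
    by (intro suminf_le hausdorff1_pre_le_outer) auto
  then show "hausdorff1_pre \<delta> (\<Union>n. A n) \<le> (\<Sum>n. hausdorff1_outer (A n))"
    using hausdorff1_pre_UN_le order_trans by blast
qed

lemma outer_measure_space_hausdorff1_outer: "outer_measure_space (Pow UNIV) hausdorff1_outer"
  by (simp add: outer_measure_space_def positive_def increasing_def countably_subadditive_def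
      hausdorff1_outer_mono hausdorff1_outer_UN_le)

lemma hausdorff1_outer_Un_le:
  "hausdorff1_outer (A \<union> B) \<le> hausdorff1_outer A + hausdorff1_outer B"
proof -
  have "subadditive (Pow UNIV) (hausdorff1_outer :: 'a set \<Rightarrow> ennreal)"
    using outer_measure_space_hausdorff1_outer
    by (intro ring_of_sets.countably_subadditive_subadditive[OF ring_of_sets_Pow])
       (auto simp: outer_measure_space_def)
  moreover have "A \<union> B = A \<union> (B - A)" by auto
  ultimately have "hausdorff1_outer (A \<union> B) \<le> hausdorff1_outer A + hausdorff1_outer (B - A)"
    unfolding subadditive_def by (metis Diff_disjoint Pow_UNIV UNIV_I)
  also have "\<dots> \<le> hausdorff1_outer A + hausdorff1_outer B"
    by (intro add_left_mono hausdorff1_outer_mono) auto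
  finally show ?thesis .
qed

lemma hausdorff1_pre_separated:
  assumes sep: "\<And>x y. x \<in> A \<Longrightarrow> y \<in> B \<Longrightarrow> \<delta> < dist x y" and "\<delta> > 0"
  shows "hausdorff1_pre \<delta> A + hausdorff1_pre \<delta> B \<le> hausdorff1_pre \<delta> (A \<union> B)"
  unfolding hausdorff1_pre_def[of \<delta> "A \<union> B"]
proof (rule INF_greatest)
  fix E assume E: "E \<in> hausdorff1_cover \<delta> (A \<union> B)"
  define F G where "F = (\<lambda>i. if E i \<inter> A = {} then {} else E i)"
    and "G = (\<lambda>i. if E i \<inter> B = {} then {} else E i)"
  have "A \<subseteq> (\<Union>i. F i)" "B \<subseteq> (\<Union>i. G i)"
    using E unfolding hausdorff1_cover_def F_def G_def by fastforce+
  moreover have "bounded (F i) \<and> diameter (F i) \<le> \<delta>" "bounded (G i) \<and> diameter (G i) \<le> \<delta>" for i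
    using E \<open>\<delta> > 0\<close> by (auto simp: hausdorff1_cover_def F_def G_def)
  ultimately have "F \<in> hausdorff1_cover \<delta> A" "G \<in> hausdorff1_cover \<delta> B"
    by (auto simp: hausdorff1_cover_def)
  then have "hausdorff1_pre \<delta> A + hausdorff1_pre \<delta> B
      \<le> (\<Sum>i. ennreal (diameter (F i))) + (\<Sum>i. ennreal (diameter (G i)))"
    by (intro add_mono hausdorff1_pre_le)
  also have "\<dots> = (\<Sum>i. ennreal (diameter (F i)) + ennreal (diameter (G i)))"
    by (rule suminf_add) auto
  also have "\<dots> \<le> (\<Sum>i. ennreal (diameter (E i)))"
  proof (intro suminf_le)
    fix i
    have "E i \<inter> A = {} \<or> E i \<inter> B = {}"
    proof (rule ccontr)
      assume "\<not> ?thesis"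
      then obtain x y where xy: "x \<in> E i" "x \<in> A" "y \<in> E i" "y \<in> B" by blast
      have "dist x y \<le> diameter (E i)"
        using E xy by (intro diameter_bounded_bound) (auto simp: hausdorff1_cover_def)
      also have "\<dots> \<le> \<delta>" using E by (auto simp: hausdorff1_cover_def)
      finally show False using sep[of x y] xy by auto
    qed
    then show "ennreal (diameter (F i)) + ennreal (diameter (G i)) \<le> ennreal (diameter (E i))"
      by (auto simp: F_def G_def diameter_def)
  qed auto
  finally show "hausdorff1_pre \<delta> A + hausdorff1_pre \<delta> B \<le> (\<Sum>i. ennreal (diameter (E i)))" .
qed

lemma hausdorff1_outer_separated:
  assumes sep: "\<And>x y. x \<in> A \<Longrightarrow> y \<in> B \<Longrightarrow> d < dist x y" and "d > 0"
  shows "hausdorff1_outer A + hausdorff1_outer B \<le> hausdorff1_outer (A \<union> B)"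
proof -
  have *: "hausdorff1_pre \<delta> A + hausdorff1_pre \<epsilon> B \<le> hausdorff1_outer (A \<union> B)"
    if "\<delta> > 0" "\<epsilon> > 0" for \<delta> \<epsilon>
  proof -
    define \<eta> where "\<eta> = min d (min \<delta> \<epsilon>)"
    have \<eta>: "\<eta> > 0" "\<eta> \<le> d" "\<eta> \<le> \<delta>" "\<eta> \<le> \<epsilon>"
      using that \<open>d > 0\<close> by (auto simp: \<eta>_def)
    have "hausdorff1_pre \<delta> A + hausdorff1_pre \<epsilon> B \<le> hausdorff1_pre \<eta> A + hausdorff1_pre \<eta> B"
      using \<eta> by (intro add_mono hausdorff1_pre_antimono)
    also have "\<dots> \<le> hausdorff1_pre \<eta> (A \<union> B)"
      using \<eta> sep by (intro hausdorff1_pre_separated) (auto intro: le_less_trans)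
    also have "\<dots> \<le> hausdorff1_outer (A \<union> B)"
      using \<eta> by (intro hausdorff1_pre_le_outer)
    finally show ?thesis .
  qed
  have ne: "{0::real<..} \<noteq> {}" by (auto intro: gt_ex)
  have "hausdorff1_outer A + hausdorff1_outer B
      = (SUP \<delta>\<in>{0<..}. hausdorff1_pre \<delta> A + hausdorff1_outer B)"
    using ne by (simp add: hausdorff1_outer_def[of A] ennreal_SUP_add_left)
  also have "\<dots> = (SUP \<delta>\<in>{0<..}. SUP \<epsilon>\<in>{0<..}. hausdorff1_pre \<delta> A + hausdorff1_pre \<epsilon> B)"
    using ne by (simp add: hausdorff1_outer_def[of B] ennreal_SUP_add_right)
  also have "\<dots> \<le> hausdorff1_outer (A \<union> B)"
    by (intro SUP_least *) auto
  finally show ?thesis .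
qed

lemma hausdorff1_outer_shells:
  fixes R :: "nat \<Rightarrow> 'a::metric_space set"
  assumes sep: "\<And>i j. i < j \<Longrightarrow> \<exists>d>0. \<forall>x\<in>R i. \<forall>y\<in>R j. d < dist x y"
    and sub: "\<And>i. R i \<subseteq> A"
  shows "(\<Sum>i. hausdorff1_outer (R i)) \<le> hausdorff1_outer A"
proof (rule suminf_le_const[OF summableI])
  fix n
  have "(\<Sum>i<n. hausdorff1_outer (R i)) \<le> hausdorff1_outer (\<Union>i<n. R i)"
  proof (induction n)
    case (Suc n)
    have "\<exists>d>0. \<forall>x\<in>(\<Union>i<m. R i). \<forall>y\<in>R n. d < dist x y" if "m \<le> n" for m
      using that
    proof (induction m)
      case 0
      show ?case by (rule exI[of _ 1]) auto
    next
      case (Suc m)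
      then obtain d where d: "d > 0" "\<And>x y. x \<in> (\<Union>i<m. R i) \<Longrightarrow> y \<in> R n \<Longrightarrow> d < dist x y"
        by force
      obtain e where e: "e > 0" "\<And>x y. x \<in> R m \<Longrightarrow> y \<in> R n \<Longrightarrow> e < dist x y"
        using sep[of m n] Suc.prems by force
      show ?case
      proof (intro exI[of _ "min d e"] conjI ballI)
        show "0 < min d e" using d e by simp
        fix x y assume "x \<in> (\<Union>i<Suc m. R i)" "y \<in> R n"
        then show "min d e < dist x y"
          using d(2)[of x y] e(2)[of x y] by (auto simp: lessThan_Suc min_less_iff_disj)
      qed
    qed
    from this[of n] obtain d
      where "d > 0" "\<And>x y. x \<in> (\<Union>i<n. R i) \<Longrightarrow> y \<in> R n \<Longrightarrow> d < dist x y"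
      by force
    then have "hausdorff1_outer (\<Union>i<n. R i) + hausdorff1_outer (R n)
        \<le> hausdorff1_outer ((\<Union>i<n. R i) \<union> R n)"
      by (intro hausdorff1_outer_separated)
    moreover have "(\<Sum>i<Suc n. hausdorff1_outer (R i))
        \<le> hausdorff1_outer (\<Union>i<n. R i) + hausdorff1_outer (R n)"
      using Suc by (simp add: add_right_mono)
    moreover have "(\<Union>i<Suc n. R i) = (\<Union>i<n. R i) \<union> R n"
      by (auto simp: lessThan_Suc)
    ultimately show ?case
      by (metis order_trans)
  qed simp
  also have "\<dots> \<le> hausdorff1_outer A"
    using sub by (intro hausdorff1_outer_mono) auto
  finally show "(\<Sum>i<n. hausdorff1_outer (R i)) \<le> hausdorff1_outer A" .
qed

lemma hausdorff1_outer_closed_split: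
  fixes C :: "'a::metric_space set"
  assumes "closed C"
  shows "hausdorff1_outer (A \<inter> C) + hausdorff1_outer (A - C) \<le> hausdorff1_outer A"
proof (cases "C = {} \<or> hausdorff1_outer A = top")
  case True
  then show ?thesis by auto
next
  case False
  then have C: "C \<noteq> {}" and fin: "hausdorff1_outer A < top"
    by (auto simp: less_top)
  define P where "P = (\<lambda>n::nat. {x\<in>A. infdist x C > 1 / Suc n})"
  define R where "R = (\<lambda>n::nat. {x\<in>A. 1 / Suc (Suc n) < infdist x C \<and> infdist x C \<le> 1 / Suc n})"
  have sepR: "\<exists>d>0. \<forall>x\<in>R i. \<forall>y\<in>R j. d < dist x y" if "Suc i < j" for i j
  proof (intro exI[of _ "(1 / Suc (Suc i) - 1 / Suc j) / 2"] conjI ballI)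
    have *: "1 / real (Suc j) < 1 / Suc (Suc i)"
      using that by (intro divide_strict_left_mono) auto
    then show "0 < (1 / real (Suc (Suc i)) - 1 / Suc j) / 2" by simp
    fix x y assume "x \<in> R i" "y \<in> R j"
    then have "1 / Suc (Suc i) < infdist x C" "infdist y C \<le> 1 / Suc j"
      by (auto simp: R_def)
    moreover have "infdist x C \<le> infdist y C + dist x y"
      by (rule infdist_triangle)
    ultimately show "(1 / Suc (Suc i) - 1 / Suc j) / 2 < dist x y"
      using * by argo
  qed
  have subR: "R i \<subseteq> A" for i by (auto simp: R_def)
  have ev: "(\<Sum>i. hausdorff1_outer (R (2 * i))) \<le> hausdorff1_outer A"
    using sepR subR by (intro hausdorff1_outer_shells) auto
  have od: "(\<Sum>i. hausdorff1_outer (R (2 * i + 1))) \<le> hausdorff1_outer A"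
    using sepR subR by (intro hausdorff1_outer_shells) auto
  define f where "f = (\<lambda>i. hausdorff1_outer (R i))"
  have "sum f {..<n} \<le> hausdorff1_outer A + hausdorff1_outer A" for n
  proof -
    have "sum f {..<n} \<le> sum f {..<2 * n}"
      by (intro sum_mono2) auto
    also have "\<dots> = (\<Sum>i<n. f (2 * i)) + (\<Sum>i<n. f (2 * i + 1))"
      by (induction n) (auto simp: algebra_simps)
    also have "\<dots> \<le> (\<Sum>i. f (2 * i)) + (\<Sum>i. f (2 * i + 1))"
      by (intro add_mono sum_le_suminf) auto
    also have "\<dots> \<le> hausdorff1_outer A + hausdorff1_outer A"
      using ev od unfolding f_def by (rule add_mono)
    finally show ?thesis .
  qed
  then have "suminf f \<le> hausdorff1_outer A + hausdorff1_outer A"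
    by (intro suminf_le_const) auto
  also have "\<dots> < top" using fin by simp
  finally have S: "suminf f < top" .
  have step: "hausdorff1_outer (A \<inter> C) + hausdorff1_outer (A - C) + sum f {..<n}
      \<le> hausdorff1_outer A + suminf f" for n
  proof -
    define T where "T = (\<lambda>i. if i < n then {} else R i)"
    have "A - C \<subseteq> P n \<union> (\<Union>i. T i)"
    proof
      fix x assume x: "x \<in> A - C"
      then have pos: "infdist x C > 0"
        using infdist_pos_not_in_closed[OF \<open>closed C\<close> C] by auto
      show "x \<in> P n \<union> (\<Union>i. T i)"
      proof (cases "x \<in> P n")
        case False
        obtain m where m: "1 / Suc m < infdist x C"
          using nat_approx_posE[OF pos] by blast
        define k where "k = (LEAST k. 1 / Suc k < infdist x C)"
        have k: "1 / Suc k < infdist x C"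
          unfolding k_def by (rule LeastI[of _ m]) (rule m)
        have least: "\<not> 1 / Suc j < infdist x C" if "j < k" for j
          using that unfolding k_def by (rule not_less_Least)
        have "n < k"
        proof (rule ccontr)
          assume "\<not> n < k"
          then have "1 / real (Suc n) \<le> 1 / Suc k"
            by (intro divide_left_mono) auto
          with k False x show False by (auto simp: P_def)
        qed
        then obtain j where j: "k = Suc j" "n \<le> j"
          by (cases k) auto
        then have "x \<in> R j"
          using k least[of j] x by (simp add: R_def not_less)
        then have "x \<in> T j" using j by (simp add: T_def)
        then show ?thesis by blast
      qed simp
    qed
    then have "hausdorff1_outer (A - C) \<le> hausdorff1_outer (P n \<union> (\<Union>i. T i))"
      by (rule hausdorff1_outer_mono)
    also have "\<dots> \<le> hausdorff1_outer (P n) + hausdorff1_outer (\<Union>i. T i)"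
      by (rule hausdorff1_outer_Un_le)
    also have "\<dots> \<le> hausdorff1_outer (P n) + (\<Sum>i. hausdorff1_outer (T i))"
      by (intro add_left_mono hausdorff1_outer_UN_le)
    finally have 1: "hausdorff1_outer (A - C) \<le> hausdorff1_outer (P n) + (\<Sum>i. hausdorff1_outer (T i))" .
    have "sum f {..<n} = (\<Sum>i. if i < n then f i else 0)"
      by (subst suminf_finite[of "{..<n}"]) (auto intro: sum.cong)
    then have "sum f {..<n} + (\<Sum>i. hausdorff1_outer (T i))
        = (\<Sum>i. (if i < n then f i else 0) + hausdorff1_outer (T i))"
      by (simp add: suminf_add)
    also have "\<dots> = suminf f"
      by (intro arg_cong[where f = suminf] ext) (simp add: T_def f_def)
    finally have 2: "sum f {..<n} + (\<Sum>i. hausdorff1_outer (T i)) = suminf f" .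
    have "hausdorff1_outer (A \<inter> C) + hausdorff1_outer (P n) \<le> hausdorff1_outer ((A \<inter> C) \<union> P n)"
    proof (rule hausdorff1_outer_separated)
      show "0 < 1 / (2 * real (Suc n))" by simp
      fix x y assume "x \<in> A \<inter> C" "y \<in> P n"
      then have "1 / Suc n < infdist y C" "infdist y C \<le> dist y x"
        by (auto simp: P_def intro: infdist_le)
      then have "1 / Suc n < dist x y" by (simp add: dist_commute)
      moreover have "1 / (2 * real (Suc n)) \<le> 1 / Suc n"
        by (intro divide_left_mono) auto
      ultimately show "1 / (2 * real (Suc n)) < dist x y" by linarith
    qed
    also have "\<dots> \<le> hausdorff1_outer A"
      by (intro hausdorff1_outer_mono) (auto simp: P_def)
    finally have 3: "hausdorff1_outer (A \<inter> C) + hausdorff1_outer (P n) \<le> hausdorff1_outer A" .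
    have "hausdorff1_outer (A \<inter> C) + hausdorff1_outer (A - C) + sum f {..<n}
        \<le> hausdorff1_outer (A \<inter> C) + (hausdorff1_outer (P n) + (\<Sum>i. hausdorff1_outer (T i)))
          + sum f {..<n}"
      by (intro add_mono 1 order_refl)
    also have "\<dots> = (hausdorff1_outer (A \<inter> C) + hausdorff1_outer (P n)) + suminf f"
      unfolding 2[symmetric] by (simp add: ac_simps)
    also have "\<dots> \<le> hausdorff1_outer A + suminf f"
      by (intro add_mono 3 order_refl)
    finally show ?thesis .
  qed
  have "hausdorff1_outer (A \<inter> C) + hausdorff1_outer (A - C) + suminf f
      = (SUP n. hausdorff1_outer (A \<inter> C) + hausdorff1_outer (A - C) + sum f {..<n})"
    by (simp add: suminf_eq_SUP ennreal_SUP_add_right)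
  also have "\<dots> \<le> hausdorff1_outer A + suminf f"
    by (intro SUP_least step)
  finally show ?thesis
    using S by (auto simp add: add.commute ennreal_add_left_cancel_le)
qed

lemma borel_subset_lambda_system_hausdorff1:
  "sets borel \<subseteq> lambda_system UNIV (Pow UNIV) (hausdorff1_outer :: 'a::metric_space set \<Rightarrow> ennreal)"
proof -
  have "measure_space UNIV (lambda_system UNIV (Pow UNIV) hausdorff1_outer)
      (hausdorff1_outer :: 'a set \<Rightarrow> ennreal)"
    by (intro sigma_algebra.caratheodory_lemma sigma_algebra_Pow outer_measure_space_hausdorff1_outer)
  then have sa: "sigma_algebra UNIV
      (lambda_system UNIV (Pow UNIV) (hausdorff1_outer :: 'a set \<Rightarrow> ennreal))"
    by (simp add: measure_space_def)
  have "Collect closed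
      \<subseteq> lambda_system UNIV (Pow UNIV) (hausdorff1_outer :: 'a set \<Rightarrow> ennreal)"
  proof
    fix C :: "'a set" assume "C \<in> Collect closed"
    then have "hausdorff1_outer (A \<inter> C) + hausdorff1_outer (A - C) = hausdorff1_outer A" for A
      using hausdorff1_outer_Un_le[of "A \<inter> C" "A - C"]
      by (intro antisym hausdorff1_outer_closed_split) (auto simp: Int_Diff_Un)
    then show "C \<in> lambda_system UNIV (Pow UNIV) hausdorff1_outer"
      unfolding algebra.lambda_system_eq[OF algebra_Pow] by auto
  qed
  then have "sigma_sets UNIV (Collect closed)
      \<subseteq> lambda_system UNIV (Pow UNIV) (hausdorff1_outer :: 'a set \<Rightarrow> ennreal)"
    by (rule sigma_algebra.sigma_sets_subset[OF sa])
  then show ?thesis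
    by (simp add: borel_eq_closed)
qed

lemma emeasure_hausdorff1:
  fixes A :: "'a::metric_space set"
  assumes "A \<in> sets borel"
  shows "emeasure hausdorff1 A = hausdorff1_outer A"
proof -
  have "measure_space UNIV (lambda_system UNIV (Pow UNIV) hausdorff1_outer)
      (hausdorff1_outer :: 'a set \<Rightarrow> ennreal)"
    by (intro sigma_algebra.caratheodory_lemma sigma_algebra_Pow outer_measure_space_hausdorff1_outer)
  moreover have "sigma_algebra UNIV (sets (borel :: 'a measure))"
    using sets.sigma_algebra_axioms[of "borel :: 'a measure"] by simp
  ultimately have "measure_space UNIV (sets borel) (hausdorff1_outer :: 'a set \<Rightarrow> ennreal)"
    using borel_subset_lambda_system_hausdorff1 by (rule measure_down)
  then show ?thesis
    using assms unfolding hausdorff1_def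
    by (intro emeasure_measure_of_sigma) (auto simp: measure_space_def)
qed

section \<open>Radon measures, supports, and rectifiability\<close>

definition radon_measure :: "'a::topological_space measure \<Rightarrow> bool" where
  "radon_measure \<mu> \<longleftrightarrow>
     sets \<mu> = sets borel \<and>
     (\<forall>K. compact K \<longrightarrow> emeasure \<mu> K < \<infinity>) \<and>
     (\<forall>A\<in>sets borel. emeasure \<mu> A = (INF U\<in>{U. open U \<and> A \<subseteq> U}. emeasure \<mu> U)) \<and>
     (\<forall>U. open U \<longrightarrow> emeasure \<mu> U = (SUP K\<in>{K. compact K \<and> K \<subseteq> U}. emeasure \<mu> K))"

definition measure_support :: "'a::metric_space measure \<Rightarrow> 'a set" where
  "measure_support \<mu> = {x. \<forall>r>0. 0 < emeasure \<mu> (ball x r)}"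

text \<open>
  The Lipschitz images below are \<open>\<sigma>\<close>-compact, hence Borel; repetitions are allowed, so indexing
  by \<^typ>\<open>nat\<close> covers finite families as well.
\<close>

definition rectifiable1 :: "'a::euclidean_space measure \<Rightarrow> bool" where
  "rectifiable1 \<mu> \<longleftrightarrow>
     (\<exists>\<gamma> :: nat \<Rightarrow> real \<Rightarrow> 'a.
        (\<forall>i. \<exists>C. C-lipschitz_on UNIV (\<gamma> i)) \<and>
        UNIV - (\<Union>i. range (\<gamma> i)) \<in> null_sets \<mu>) \<and>
     absolutely_continuous hausdorff1 \<mu>"

section \<open>The coefficients \<open>\<alpha>\<close>\<close>

definition lip1_supported :: "'a::euclidean_space set \<Rightarrow> ('a \<Rightarrow> real) set" where
  "lip1_supported B = {\<phi>. 1-lipschitz_on UNIV \<phi> \<and> closure {x. \<phi> x \<noteq> 0} \<subseteq> B}"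

text \<open>
  For locally finite Borel measures the integrals below exist, since the test functions are
  continuous with compact support whenever \<open>B\<close> is bounded.
\<close>

definition flat_dist ::
    "'a::euclidean_space set \<Rightarrow> 'a measure \<Rightarrow> 'a measure \<Rightarrow> ennreal" where
  "flat_dist B \<sigma> \<nu> =
     (SUP \<phi>\<in>lip1_supported B. ennreal \<bar>(\<integral>x. \<phi> x \<partial>\<sigma>) - (\<integral>x. \<phi> x \<partial>\<nu>)\<bar>)"

definition lines :: "'a::euclidean_space set set" where
  "lines = {L. affine L \<and> aff_dim L = 1}"

definition flat_measure :: "real \<Rightarrow> 'a::euclidean_space set \<Rightarrow> 'a measure" where
  "flat_measure c L = scale_measure (ennreal c) (density hausdorff1 (indicator L))"

text \<open>
  The value is meaningful only for \<open>r > 0\<close> and \<open>0 < \<mu> (ball x r) < \<infinity>\<close>. The numerator is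
  nondecreasing in \<open>r\<close>, so \<open>\<alpha>\<close> is Borel measurable in \<open>r\<close> and nonnegative integrals over \<open>r\<close>
  have their usual meaning.
\<close>

definition alpha1 :: "'a::euclidean_space measure \<Rightarrow> 'a \<Rightarrow> real \<Rightarrow> ennreal" where
  "alpha1 \<mu> x r =
     (INF c\<in>{0..}. INF L\<in>lines. flat_dist (ball x r) \<mu> (flat_measure c L))
       / (ennreal r * emeasure \<mu> (ball x r))"

end

theory Submission
  imports Defs "HOL-Probability.Infinite_Product_Measure" "HOL-Probability.Probability_Mass_Function"
begin

text \<open>
  The measure is the product of Lebesgue measure on horizontal lines with an atomless Cantor measure on
  the vertical axis. At stage \<open>n\<close> every line is replaced by two parallel lines at distance \<open>h n\<close>, carrying
  the fractions \<open>1 - \<epsilon> n\<close> and \<open>\<epsilon> n\<close> of its density. Since \<open>\<Sum>\<epsilon> n\<close> diverges, the density tends to \<open>0\<close> at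
  every point, uniformly, so Lipschitz curves are null sets. From the heavy line, \<open>\<alpha>\<close> is at most of
  order \<open>\<epsilon> n * h n / r\<close> at scales \<open>r\<close> above \<open>h n\<close>. From the light line the danger is the transition
  \<open>r \<approx> h n\<close> at which the heavy line enters the ball. While \<open>r \<le> (1 + sqrt (\<epsilon> n)) * h n\<close> the heavy line is
  close to the boundary of the ball, where test functions are small, and for larger \<open>r\<close> it already dominates
  the mass of the ball. The transition costs \<open>O((\<epsilon> n) powr (3/2))\<close> in the square function, which is
  summable for \<open>\<epsilon> n = 1 / (n + 2)\<close>.
\<close>

section \<open>Hausdorff measure on horizontal lines\<close>

definition pt :: "real \<Rightarrow> real \<Rightarrow> real^2" where
  "pt u s = vector [u, s]"

lemma pt_nth [simp]: "pt u s $ 1 = u" "pt u s $ 2 = s"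
  by (simp_all add: pt_def)

lemma pt_eq_iff: "x = pt u s \<longleftrightarrow> x $ 1 = u \<and> x $ 2 = s"
  by (auto simp: vec_eq_iff forall_2)

lemma dist_real2: "dist x y = sqrt ((x $ 1 - y $ 1)\<^sup>2 + (x $ 2 - y $ 2)\<^sup>2)" for x y :: "real^2"
  by (simp add: dist_vec_def L2_set_def UNIV_2 dist_real_def)

lemma dist_pt: "dist (pt u s) (pt v t) = sqrt ((u - v)\<^sup>2 + (s - t)\<^sup>2)"
  by (simp add: dist_real2)

lemma continuous_on_pt [continuous_intros]:
  fixes f g :: "'a::topological_space \<Rightarrow> real"
  assumes "continuous_on S f" "continuous_on S g"
  shows "continuous_on S (\<lambda>x. pt (f x) (g x))"
proof -
  have "pt u s = (\<chi> i. if i = 1 then u else s)" for u s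
    by (auto simp: vec_eq_iff forall_2)
  moreover have "continuous_on S (\<lambda>x. if i = 1 then f x else g x)" for i :: 2
    using assms by (cases "i = 1") auto
  ultimately show ?thesis
    by (simp add: continuous_on_vec_lambda)
qed

lemma measurable_pt [measurable]:
  assumes [measurable]: "f \<in> borel_measurable M" "g \<in> borel_measurable M"
  shows "(\<lambda>x. pt (f x) (g x)) \<in> borel_measurable M"
proof -
  have "(\<lambda>p. pt (fst p) (snd p)) \<in> borel_measurable borel"
    by (intro borel_measurable_continuous_onI continuous_intros)
  then have "(\<lambda>p. pt (fst p) (snd p)) \<in> borel \<Otimes>\<^sub>M borel \<rightarrow>\<^sub>M borel"
    by (simp add: borel_prod)
  from measurable_compose[OF _ this, of "\<lambda>x. (f x, g x)" M] show ?thesis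
    by simp
qed

lemma borel_measurable_vec_nth [measurable]: "(\<lambda>x::real^2. x $ i) \<in> borel_measurable borel"
  by (intro borel_measurable_continuous_onI continuous_intros)

definition hline :: "real \<Rightarrow> (real^2) set" where
  "hline s = range (\<lambda>u. pt u s)"

lemma mem_hline_iff: "x \<in> hline s \<longleftrightarrow> x $ 2 = s"
  by (auto simp: hline_def pt_eq_iff image_iff)

lemma hline_borel [measurable]: "hline s \<in> sets borel"
proof -
  have "hline s = {x \<in> space borel. x $ 2 = s}"
    by (auto simp: mem_hline_iff)
  also have "\<dots> \<in> sets borel" by measurable
  finally show ?thesis .
qed

lemma hline_in_lines: "hline s \<in> lines"
proof -
  have "hline s = affine hull {pt 0 s, pt 1 s}"
  proof (intro set_eqI iffI)
    fix x assume "x \<in> hline s"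
    then have "x = (1 - x $ 1) *\<^sub>R pt 0 s + (x $ 1) *\<^sub>R pt 1 s"
      by (auto simp: mem_hline_iff vec_eq_iff forall_2 algebra_simps)
    then show "x \<in> affine hull {pt 0 s, pt 1 s}"
      unfolding affine_hull_2 by (intro CollectI exI[of _ "1 - x $ 1"] exI[of _ "x $ 1"]) auto
  next
    fix x assume "x \<in> affine hull {pt 0 s, pt 1 s}"
    then show "x \<in> hline s"
      unfolding affine_hull_2 by (auto simp: mem_hline_iff simp flip: distrib_right)
  qed
  moreover have "pt 0 s \<noteq> pt 1 s" by (simp add: pt_eq_iff)
  ultimately show ?thesis
    by (simp add: lines_def aff_dim_affine_hull aff_dim_2)
qed

section \<open>Hausdorff measure restricted to a horizontal line is Lebesgue measure\<close>

lemma bounded_real_diameter: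
  fixes S :: "real set"
  assumes "bounded S" "S \<noteq> {}"
  shows "S \<subseteq> {Inf S..Sup S}" "Sup S - Inf S \<le> diameter S"
proof -
  have bdd: "bdd_above S" "bdd_below S"
    using assms by (auto simp: bounded_imp_bdd_above bounded_imp_bdd_below)
  then show "S \<subseteq> {Inf S..Sup S}"
    by (auto intro: cInf_lower cSup_upper)
  have "Sup S \<le> Inf S + diameter S"
  proof (rule cSup_least[OF assms(2)])
    fix t assume t: "t \<in> S"
    have "t - diameter S \<le> Inf S"
    proof (rule cInf_greatest[OF assms(2)])
      fix s assume "s \<in> S"
      then show "t - diameter S \<le> s"
        using diameter_bounded_bound[OF assms(1) t, of s] by (auto simp: dist_real_def)
    qed
    then show "t \<le> Inf S + diameter S" by simp
  qed
  then show "Sup S - Inf S \<le> diameter S" by simp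
qed

text \<open>Cutting the segment into short equal pieces bounds the measure from above. From below, a
  cover is projected to the first axis, which does not increase diameters, and each projection is
  enclosed in an interval; subadditivity of Lebesgue measure finishes. Open segments are the sets on
  which \<open>lborel_eqI\<close> tests a measure.\<close>

lemma hausdorff1_hseg:
  assumes "l \<le> u"
  shows "emeasure hausdorff1 {x \<in> hline s. x $ 1 \<in> {l<..<u}} = ennreal (u - l)" (is "emeasure _ ?S = _")
proof -
  have "?S = {x \<in> space borel. x \<in> hline s \<and> x $ 1 \<in> {l<..<u}}" by auto
  also have "\<dots> \<in> sets borel" by measurable
  finally have "emeasure hausdorff1 ?S = hausdorff1_outer ?S"
    by (rule emeasure_hausdorff1)
  also have "\<dots> = ennreal (u - l)"
  proof (rule antisym)
    show "hausdorff1_outer ?S \<le> ennreal (u - l)"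
      unfolding hausdorff1_outer_def
    proof (rule SUP_least)
      fix \<delta> :: real assume "\<delta> \<in> {0<..}"
      then have \<delta>: "\<delta> > 0" by simp
      obtain N :: nat where N: "(u - l) / \<delta> < N" using reals_Archimedean2 by blast
      have "(u - l) / \<delta> \<ge> 0" using assms \<delta> by simp
      then have N0: "N > 0" using N by (cases N) auto
      define w where "w = (u - l) / N"
      have w: "0 \<le> w" "w \<le> \<delta>" "N * w = u - l"
        using N N0 \<delta> assms by (auto simp: w_def field_simps)
      \<comment> \<open>\<open>N\<close> was chosen so that each piece has length \<open>w\<close>
        at most \<open>\<delta>\<close>; the empty sets after the first \<open>N\<close> only fill
        up the sequence.\<close>
      define E where "E = (\<lambda>i. if i < N then (\<lambda>t. pt t s) ` {l + i * w..l + Suc i * w} else {})"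
      have diam: "diameter (E i) \<le> (if i < N then w else 0)" for i
      proof (cases "i < N")
        case True
        have "l + i * w \<le> l + Suc i * w" using w by (simp add: algebra_simps)
        then have "diameter (E i) \<le> w"
          using True w(1) by (intro diameter_le) (auto simp: E_def dist_pt dist_norm[symmetric] abs_le_iff algebra_simps)
        then show ?thesis using True by simp
      qed (simp add: E_def diameter_def)
      have bdd: "bounded (E i)" for i
        unfolding E_def by (auto intro!: compact_imp_bounded compact_continuous_image continuous_intros)
      have cov: "?S \<subseteq> (\<Union>i. E i)"
      proof
        fix x assume x: "x \<in> ?S"
        then have w0: "w > 0" using N0 by (auto simp: w_def)
        define i where "i = nat \<lfloor>(x $ 1 - l) / w\<rfloor>"
        have *: "(x $ 1 - l) / w \<ge> 0" using x w0 by simp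
        then have i: "real i \<le> (x $ 1 - l) / w" "(x $ 1 - l) / w < real i + 1"
          by (auto simp: i_def)
        then have i': "real i * w \<le> x $ 1 - l" "x $ 1 - l \<le> (real i + 1) * w"
          using w0 by (auto simp: field_simps)
        have "real i * w < N * w" using i' x w by auto
        then have "i < N" using w0 by simp
        then have "x \<in> E i"
          using i' x by (auto simp: E_def mem_hline_iff pt_eq_iff algebra_simps intro!: image_eqI[of _ _ "x $ 1"])
        then show "x \<in> (\<Union>i. E i)" by blast
      qed
      have "diameter (E i) \<le> \<delta>" for i
        using diam[of i] w \<delta> by (auto split: if_splits)
      then have "hausdorff1_pre \<delta> ?S \<le> (\<Sum>i. ennreal (diameter (E i)))"
        using bdd cov by (intro hausdorff1_pre_le) (auto simp: hausdorff1_cover_def)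
      also have "\<dots> \<le> (\<Sum>i. ennreal (if i < N then w else 0))"
        by (intro suminf_le ennreal_leI diam) auto
      also have "\<dots> = (\<Sum>i<N. ennreal w)"
        by (subst suminf_finite[of "{..<N}"]) auto
      also have "\<dots> = ennreal (u - l)"
        using w by (simp add: ennreal_of_nat_eq_real_of_nat flip: ennreal_mult)
      finally show "hausdorff1_pre \<delta> ?S \<le> ennreal (u - l)" .
    qed
    \<comment> \<open>A lower bound at the single scale 1 suffices, since the outer measure is the
      supremum over all scales.\<close>
    have "ennreal (u - l) \<le> hausdorff1_pre 1 ?S"
      unfolding hausdorff1_pre_def
    proof (rule INF_greatest)
      fix E :: "nat \<Rightarrow> (real^2) set" assume E: "E \<in> hausdorff1_cover 1 ?S"
      define p where "p = (\<lambda>i. (\<lambda>x. x $ 1) ` E i)"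
      \<comment> \<open>The case split is there because \<open>Inf\<close> and \<open>Sup\<close> of
        the empty set carry no information.\<close>
      define J where "J = (\<lambda>i. if E i = {} then {} else {Inf (p i)..Sup (p i)})"
      have bE: "bounded (E i)" for i using E by (auto simp: hausdorff1_cover_def)
      have dp: "dist (x $ 1) (y $ 1) \<le> dist x y" for x y :: "real^2"
        by (simp add: dist_vec_nth_le)
      have bp: "bounded (p i)" for i
        unfolding p_def by (intro bounded_linear_image bE bounded_linear_vec_nth)
      have Jm: "emeasure lborel (J i) \<le> ennreal (diameter (E i))" for i
      proof (cases "E i = {}")
        case False
        then have ne: "p i \<noteq> {}" by (simp add: p_def)
        have "diameter (p i) \<le> diameter (E i)"
        proof (rule diameter_le)
          fix a b assume "a \<in> p i" "b \<in> p i"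
          then obtain x y where "x \<in> E i" "y \<in> E i" "a = x $ 1" "b = y $ 1"
            by (auto simp: p_def)
          then show "norm (a - b) \<le> diameter (E i)"
            using dp[of x y] diameter_bounded_bound[OF bE[of i], of x y] by (simp add: dist_norm)
        qed (use ne in simp)
        with bounded_real_diameter[OF bp ne]
        have "Inf (p i) \<le> Sup (p i)" "Sup (p i) - Inf (p i) \<le> diameter (E i)"
          using ne by (auto dest: subsetD)
        then show ?thesis using False by (simp add: J_def ennreal_leI)
      qed (simp add: J_def)
      have "{l<..<u} \<subseteq> (\<Union>i. J i)"
      proof
        fix t assume t: "t \<in> {l<..<u}"
        then have "pt t s \<in> ?S" by (simp add: mem_hline_iff)
        then obtain i where i: "pt t s \<in> E i" using E by (auto simp: hausdorff1_cover_def)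
        then have "t \<in> p i" unfolding p_def by (intro image_eqI[of _ _ "pt t s"]) auto
        with i bounded_real_diameter(1)[OF bp, of i] have "t \<in> J i"
          using \<open>t \<in> p i\<close> by (force simp: J_def simp del: atLeastAtMost_iff)
        then show "t \<in> (\<Union>i. J i)" by blast
      qed
      then have "emeasure lborel {l<..<u} \<le> emeasure lborel (\<Union>i. J i)"
        by (intro emeasure_mono) (auto simp: J_def)
      also have "\<dots> \<le> (\<Sum>i. emeasure lborel (J i))"
        by (intro emeasure_subadditive_countably) (auto simp: J_def)
      also have "\<dots> \<le> (\<Sum>i. ennreal (diameter (E i)))"
        by (intro suminf_le Jm) auto
      finally show "ennreal (u - l) \<le> (\<Sum>i. ennreal (diameter (E i)))"
        using assms by simp
    qed
    also have "\<dots> \<le> hausdorff1_outer ?S" by (intro hausdorff1_pre_le_outer) simp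
    finally show "ennreal (u - l) \<le> hausdorff1_outer ?S" .
  qed
  finally show ?thesis .
qed

text \<open>The projection of the restricted measure to the first axis agrees with Lebesgue measure
  on open intervals, hence everywhere. Lifting back to the line loses nothing, because the measure
  lives on that line.\<close>

lemma density_hausdorff1_hline:
  "density hausdorff1 (indicator (hline s)) = distr lborel borel (\<lambda>u. pt u s)" (is "?D = _")
proof -
  have emD: "emeasure ?D A = emeasure hausdorff1 (hline s \<inter> A)" if "A \<in> sets borel" for A
  proof -
    have "emeasure ?D A = (\<integral>\<^sup>+x. indicator (hline s \<inter> A) x \<partial>hausdorff1)"
      using that by (subst emeasure_density) (auto intro!: nn_integral_cong split: split_indicator simp del: nn_integral_indicator)
    also have "\<dots> = emeasure hausdorff1 (hline s \<inter> A)"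
      using that by (intro nn_integral_indicator) auto
    finally show ?thesis .
  qed
  define N where "N = distr ?D borel (\<lambda>x. x $ 1)"
  have "lborel = N"
  proof (rule lborel_eqI)
    fix l u :: real assume lu: "\<And>b. b \<in> Basis \<Longrightarrow> l \<bullet> b \<le> u \<bullet> b"
    have "emeasure N (box l u) = emeasure ?D {x. x $ 1 \<in> {l<..<u}}"
      unfolding N_def by (subst emeasure_distr) (auto simp: vimage_def intro!: arg_cong[where f="emeasure _"])
    also have "\<dots> = emeasure hausdorff1 (hline s \<inter> {x. x $ 1 \<in> {l<..<u}})"
      by (rule emD) measurable
    also have "hline s \<inter> {x. x $ 1 \<in> {l<..<u}} = {x \<in> hline s. x $ 1 \<in> {l<..<u}}" by auto
    also have "emeasure hausdorff1 \<dots> = ennreal (u - l)"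
      using lu by (intro hausdorff1_hseg) auto
    finally show "emeasure N (box l u) = (\<Prod>b\<in>Basis. (u - l) \<bullet> b)" by simp
  qed (simp add: N_def)
  show ?thesis
  proof (rule measure_eqI)
    fix A assume "A \<in> sets ?D"
    then have [measurable]: "A \<in> sets borel" by simp
    have "emeasure (distr lborel borel (\<lambda>u. pt u s)) A = emeasure N {u. pt u s \<in> A}"
      by (subst emeasure_distr) (auto simp: vimage_def \<open>lborel = N\<close>[symmetric])
    also have "\<dots> = emeasure ?D {x. pt (x $ 1) s \<in> A}"
      unfolding N_def by (subst emeasure_distr) (auto simp: vimage_def intro!: arg_cong[where f="emeasure _"])
    also have "\<dots> = emeasure hausdorff1 (hline s \<inter> {x. pt (x $ 1) s \<in> A})"
      by (rule emD) measurable
    also have "hline s \<inter> {x. pt (x $ 1) s \<in> A} = hline s \<inter> A"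
      by (auto simp: hline_def)
    also have "emeasure hausdorff1 \<dots> = emeasure ?D A" by (simp add: emD)
    finally show "emeasure ?D A = emeasure (distr lborel borel (\<lambda>u. pt u s)) A" by simp
  qed simp
qed

lemma scale_measure_eq_density: "scale_measure c M = density M (\<lambda>_. c)"
  by (rule measure_eqI) (auto simp: emeasure_density nn_integral_cmult_indicator)

lemma integral_flat_measure_hline:
  fixes \<phi> :: "real^2 \<Rightarrow> real"
  assumes [measurable]: "\<phi> \<in> borel_measurable borel" and "c \<ge> 0"
  shows "(\<integral>x. \<phi> x \<partial>flat_measure c (hline s)) = c * (\<integral>u. \<phi> (pt u s) \<partial>lborel)"
proof -
  have "(\<integral>x. \<phi> x \<partial>flat_measure c (hline s)) = c * (\<integral>x. \<phi> x \<partial>distr lborel borel (\<lambda>u. pt u s))"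
    unfolding flat_measure_def density_hausdorff1_hline scale_measure_eq_density
    by (subst integral_density) (auto simp: assms)
  then show ?thesis by (simp add: integral_distr)
qed

section \<open>Locally finite measures and Lipschitz curves\<close>

text \<open>Inner regularity on open sets comes from a compact exhaustion. For outer regularity the
  set is cut into the annular pieces \<open>S n\<close>, each piece is approximated up to
  \<open>e * (1/2)^Suc n\<close>, and the approximating open sets are united.\<close>

lemma radon_measure_locally_finite:
  fixes \<mu> :: "'a::euclidean_space measure"
  assumes sets: "sets \<mu> = sets borel" and fin: "\<And>K. compact K \<Longrightarrow> emeasure \<mu> K < \<infinity>"
  shows "radon_measure \<mu>"
  unfolding radon_measure_def
proof (intro conjI allI impI ballI)
  note [measurable_cong] = sets
  have spc: "space \<mu> = UNIV" using sets_eq_imp_space_eq[OF sets] by simp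
  show "sets \<mu> = sets borel" by (rule sets)
  show "emeasure \<mu> K < \<infinity>" if "compact K" for K using that by (rule fin)
  show "emeasure \<mu> U = (SUP K\<in>{K. compact K \<and> K \<subseteq> U}. emeasure \<mu> K)" if U: "open U" for U
  proof (rule antisym)
    show "(SUP K\<in>{K. compact K \<and> K \<subseteq> U}. emeasure \<mu> K) \<le> emeasure \<mu> U"
      using U by (intro SUP_least emeasure_mono) (auto simp: sets)
    obtain C :: "nat \<Rightarrow> 'a set" where C: "\<And>n. compact (C n)" "\<And>n. C n \<subseteq> U"
        "\<And>n. C n \<subseteq> interior (C (Suc n))" "\<Union> (range C) = U"
      by (rule open_Union_compact_subsets[OF U], rule that)
    have "incseq C" using C(3) interior_subset by (intro incseq_SucI) blast
    then have "(SUP n. emeasure \<mu> (C n)) = emeasure \<mu> (\<Union>n. C n)"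
      using C(1) by (intro SUP_emeasure_incseq) (auto simp: sets intro: borel_compact)
    then have "emeasure \<mu> U = (SUP n. emeasure \<mu> (C n))" using C(4) by simp
    also have "\<dots> \<le> (SUP K\<in>{K. compact K \<and> K \<subseteq> U}. emeasure \<mu> K)"
      using C by (intro SUP_least SUP_upper) auto
    finally show "emeasure \<mu> U \<le> (SUP K\<in>{K. compact K \<and> K \<subseteq> U}. emeasure \<mu> K)" .
  qed
  fix A :: "'a set" assume A[measurable]: "A \<in> sets borel"
  show "emeasure \<mu> A = (INF U\<in>{U. open U \<and> A \<subseteq> U}. emeasure \<mu> U)"
  proof (rule antisym)
    show "emeasure \<mu> A \<le> (INF U\<in>{U. open U \<and> A \<subseteq> U}. emeasure \<mu> U)"
      by (intro INF_greatest emeasure_mono) (auto simp: sets)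
    show "(INF U\<in>{U. open U \<and> A \<subseteq> U}. emeasure \<mu> U) \<le> emeasure \<mu> A"
    proof (rule ennreal_le_epsilon)
      fix e :: real assume e: "e > 0"
      define S where "S n = {x\<in>A. real n \<le> norm x \<and> norm x < real (Suc n)}" for n
      have Sm[measurable]: "S n \<in> sets borel" for n
        unfolding S_def by measurable
      have disj: "disjoint_family S"
      proof (clarsimp simp: disjoint_family_on_def)
        fix m n :: nat assume "m \<noteq> n"
        then show "S m \<inter> S n = {}" by (auto simp: S_def)
      qed
      have AS: "A = (\<Union>n. S n)"
      proof (intro set_eqI iffI)
        fix x assume "x \<in> A"
        then have "x \<in> S (nat \<lfloor>norm x\<rfloor>)" unfolding S_def by simp linarith
        then show "x \<in> (\<Union>n. S n)" by blast
      qed (auto simp: S_def)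
      have "\<exists>V. open V \<and> S n \<subseteq> V \<and> emeasure \<mu> V \<le> emeasure \<mu> (S n) + ennreal (e * (1/2)^Suc n)" for n
      proof -
        \<comment> \<open>\<open>outer_regular\<close> speaks of finite measures, so
          \<open>\<mu>\<close> is cut off to a ball containing \<open>S n\<close>; intersecting the
          resulting open set with \<open>B\<close> turns the estimate back into one for
          \<open>\<mu>\<close>.\<close>
        define B where "B = ball (0::'a) (real (Suc n))"
        define \<nu> where "\<nu> = density \<mu> (indicator B)"
        have [measurable]: "B \<in> sets borel" by (simp add: B_def)
        have em: "emeasure \<nu> X = emeasure \<mu> (B \<inter> X)" if "X \<in> sets borel" for X
          using that unfolding \<nu>_def
          by (subst emeasure_density) (auto simp: sets nn_integral_indicator[symmetric] simp del: nn_integral_indicator intro!: nn_integral_cong split: split_indicator)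
        have finB: "emeasure \<mu> B < \<infinity>"
          using fin[of "cball 0 (real (Suc n))"]
          by (rule le_less_trans[rotated]) (auto intro!: emeasure_mono simp: sets B_def)
        have sn: "sets \<nu> = sets borel" by (simp add: \<nu>_def sets)
        have "emeasure \<nu> (space \<nu>) \<noteq> \<infinity>"
          using finB by (simp add: \<nu>_def spc em[unfolded \<nu>_def])
        from outer_regular[OF sn this Sm[of n]]
        have INF: "emeasure \<nu> (S n) = (INF U\<in>{U. S n \<subseteq> U \<and> open U}. emeasure \<nu> U)" .
        have SB: "B \<inter> S n = S n" by (auto simp: S_def B_def)
        have "emeasure \<nu> (S n) < emeasure \<nu> (S n) + ennreal (e * (1/2)^Suc n)"
        proof -
          have "emeasure \<mu> (S n) \<le> emeasure \<mu> B" using SB by (intro emeasure_mono) (auto simp: sets)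
          then have "emeasure \<nu> (S n) < \<infinity>" using finB em[OF Sm] SB by (auto intro: le_less_trans)
          then show ?thesis using e by simp
        qed
        then obtain U where U: "S n \<subseteq> U" "open U"
            "emeasure \<nu> U < emeasure \<nu> (S n) + ennreal (e * (1/2)^Suc n)"
          unfolding INF INF_less_iff by auto
        show ?thesis
        proof (intro exI[of _ "B \<inter> U"] conjI)
          show "open (B \<inter> U)" using U by (auto simp: B_def)
          show "S n \<subseteq> B \<inter> U" using U SB by auto
          show "emeasure \<mu> (B \<inter> U) \<le> emeasure \<mu> (S n) + ennreal (e * (1/2)^Suc n)"
            using U em[of U] em[OF Sm] SB by simp
        qed
      qed
      then obtain V where V: "\<And>n. open (V n)" "\<And>n. S n \<subseteq> V n"
          "\<And>n. emeasure \<mu> (V n) \<le> emeasure \<mu> (S n) + ennreal (e * (1/2)^Suc n)"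
        by metis
      have "(INF U\<in>{U. open U \<and> A \<subseteq> U}. emeasure \<mu> U) \<le> emeasure \<mu> (\<Union>n. V n)"
        using V AS by (intro INF_lower) auto
      also have "\<dots> \<le> (\<Sum>n. emeasure \<mu> (V n))"
        using V by (intro emeasure_subadditive_countably) (auto simp: sets)
      also have "\<dots> \<le> (\<Sum>n. emeasure \<mu> (S n) + ennreal (e * (1/2)^Suc n))"
        by (intro suminf_le V) auto
      also have "\<dots> = (\<Sum>n. emeasure \<mu> (S n)) + (\<Sum>n. ennreal (e * (1/2)^Suc n))"
        by (rule suminf_add[symmetric]) auto
      also have "(\<Sum>n. emeasure \<mu> (S n)) = emeasure \<mu> A"
        unfolding AS by (rule suminf_emeasure) (auto simp: sets disj)
      also have "(\<Sum>n. ennreal (e * (1/2)^Suc n)) = ennreal e"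
        using e sums_mult[OF power_half_series, of e] by (intro suminf_ennreal_eq) auto
      finally show "(INF U\<in>{U. open U \<and> A \<subseteq> U}. emeasure \<mu> U) \<le> emeasure \<mu> A + ennreal e" .
    qed
  qed
qed

text \<open>The image of a unit interval is covered by \<open>N + 1\<close> balls of radius
  \<open>D / N\<close>. Their radii add up to at most \<open>2 * D\<close>, while each mass is at
  most \<open>e / D\<close> times the radius; so the image has mass at most \<open>2 * e\<close>.
  The density bound must be uniform in the centre for this.\<close>

lemma lipschitz_range_null:
  fixes \<mu> :: "'a::euclidean_space measure" and \<gamma> :: "real \<Rightarrow> 'a"
  assumes sets: "sets \<mu> = sets borel" and lip: "C-lipschitz_on UNIV \<gamma>"
    and dens: "\<And>e. e > 0 \<Longrightarrow> \<exists>\<rho>0>0. \<forall>z \<rho>. 0 < \<rho> \<and> \<rho> < \<rho>0 \<longrightarrow> emeasure \<mu> (cball z \<rho>) \<le> ennreal (e * \<rho>)"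
  shows "range \<gamma> \<in> null_sets \<mu>"
proof -
  have cont: "continuous_on UNIV \<gamma>" using lip by (rule lipschitz_on_continuous_on)
  \<comment> \<open>Adding 1 makes the Lipschitz constant positive, so that it can be divided
    by.\<close>
  define D where "D = C + 1"
  have D: "D > 0" "dist (\<gamma> s) (\<gamma> t) \<le> D * dist s t" for s t
  proof -
    have "C \<ge> 0" using lip by (rule lipschitz_on_nonneg)
    then show "D > 0" by (simp add: D_def)
    have "dist (\<gamma> s) (\<gamma> t) \<le> C * dist s t" using lip by (auto dest: lipschitz_onD)
    then show "dist (\<gamma> s) (\<gamma> t) \<le> D * dist s t"
      using zero_le_dist[of s t] unfolding D_def distrib_right by linarith
  qed
  have piece: "\<gamma> ` {k..k+1} \<in> null_sets \<mu>" for k :: real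
  proof -
    have mb: "\<gamma> ` {k..k+1} \<in> sets borel"
      by (auto intro!: borel_compact compact_continuous_image continuous_on_subset[OF cont])
    have *: "emeasure \<mu> (\<gamma> ` {k..k+1}) \<le> ennreal (e * 2)" if e: "e > 0" for e
    proof -
      obtain \<rho>0 where \<rho>0: "\<rho>0 > 0"
          "\<And>z \<rho>. 0 < \<rho> \<Longrightarrow> \<rho> < \<rho>0 \<Longrightarrow> emeasure \<mu> (cball z \<rho>) \<le> ennreal (e / D * \<rho>)"
        using dens[of "e / D"] e D by auto
      obtain N :: nat where N: "D / \<rho>0 < N" using reals_Archimedean2 by blast
      have "0 < D / \<rho>0" using D \<rho>0 by simp
      then have "real N > 0" using N by linarith
      then have N0: "N > 0" by simp
      define \<rho> where "\<rho> = D / N"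
      have \<rho>: "0 < \<rho>" "\<rho> < \<rho>0" "N * \<rho> = D"
        using N N0 D \<rho>0 by (auto simp: \<rho>_def field_simps)
      have "\<gamma> ` {k..k+1} \<subseteq> (\<Union>i\<in>{..N}. cball (\<gamma> (k + i / N)) \<rho>)"
      proof clarify
        fix t assume t: "t \<in> {k..k+1}"
        define i where "i = nat \<lfloor>(t - k) * N\<rfloor>"
        have "(t - k) * N \<ge> 0" using t by simp
        then have i: "real i \<le> (t - k) * N" "(t - k) * N \<le> real i + 1"
          by (auto simp: i_def)
        have "(t - k) * real N \<le> 1 * real N" using t by (intro mult_right_mono) auto
        then have "real i \<le> N" using i by linarith
        then have "i \<le> N" by simp
        have "real i / N \<le> t - k" "t - k \<le> (real i + 1) / N"
          using i N0 by (simp_all add: field_simps)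
        then have "k + i / N - t \<le> 1 / N" "t - (k + i / N) \<le> 1 / N"
          using add_divide_distrib[of "real i" 1 "real N"] zero_le_divide_1_iff[of "real N"] by linarith+
        then have "dist (k + i / N) t \<le> 1 / N"
          unfolding dist_real_def by (intro abs_leI) simp_all
        then have "D * dist (k + i / N) t \<le> D * (1 / N)"
          using D(1) by (intro mult_left_mono) auto
        then have "D * dist (k + i / N) t \<le> \<rho>"
          unfolding \<rho>_def by (simp only: times_divide_eq_right mult_1_right)
        then have "\<gamma> t \<in> cball (\<gamma> (k + i / N)) \<rho>"
          unfolding mem_cball by (rule order_trans[OF D(2)])
        then show "\<gamma> t \<in> (\<Union>i\<in>{..N}. cball (\<gamma> (k + i / N)) \<rho>)" using \<open>i \<le> N\<close> by blast
      qed
      then have "emeasure \<mu> (\<gamma> ` {k..k+1}) \<le> emeasure \<mu> (\<Union>i\<in>{..N}. cball (\<gamma> (k + i / N)) \<rho>)"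
        by (intro emeasure_mono) (auto simp: sets)
      also have "\<dots> \<le> (\<Sum>i\<in>{..N}. emeasure \<mu> (cball (\<gamma> (k + i / N)) \<rho>))"
        by (intro emeasure_subadditive_finite) (auto simp: sets)
      also have "\<dots> \<le> (\<Sum>i\<in>{..N}. ennreal (e / D * \<rho>))"
        by (intro sum_mono \<rho>0 \<rho>)
      also have "\<dots> = ennreal (\<Sum>i\<in>{..N}. e / D * \<rho>)"
        using e D \<rho> by (intro sum_ennreal) auto
      also have "(\<Sum>i\<in>{..N}. e / D * \<rho>) = e * ((N + 1) / N)"
        using D N0 by (simp add: \<rho>_def)
      also have "\<dots> \<le> e * 2" using e N0 by (intro mult_left_mono) (simp_all add: divide_le_eq)
      finally show ?thesis by (simp add: ennreal_leI)
    qed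
    have "emeasure \<mu> (\<gamma> ` {k..k+1}) \<le> 0 + ennreal e" if "e > 0" for e
      using *[of "e / 2"] that by simp
    then have "emeasure \<mu> (\<gamma> ` {k..k+1}) \<le> 0" by (rule ennreal_le_epsilon)
    then have "emeasure \<mu> (\<gamma> ` {k..k+1}) = 0" by simp
    then show ?thesis by (rule null_setsI) (simp only: mb sets)
  qed
  have "range \<gamma> = (\<Union>k::int. \<gamma> ` {of_int k..of_int k + 1})"
  proof (intro set_eqI iffI)
    fix x assume "x \<in> range \<gamma>"
    then obtain t where t: "x = \<gamma> t" by auto
    have "t \<in> {of_int \<lfloor>t\<rfloor>..of_int \<lfloor>t\<rfloor> + 1}" by simp
    then show "x \<in> (\<Union>k::int. \<gamma> ` {of_int k..of_int k + 1})"
      unfolding t by (intro UN_I[OF UNIV_I] imageI)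
  qed auto
  moreover have "(\<Union>k::int. \<gamma> ` {of_int k..of_int k + 1}) \<in> null_sets \<mu>"
    by (intro null_sets_UN' piece countableI_type)
  ultimately show ?thesis by metis
qed

section \<open>A Cantor measure with unequal weights\<close>

text \<open>
  At level \<open>n\<close> a cell is split into a main part of relative weight \<open>1 - eps n\<close> (digit \<^const>\<open>False\<close>) and a
  side part of relative weight \<open>eps n\<close> (digit \<^const>\<open>True\<close>), shifted by \<open>hs n\<close>. The requirements are that
  \<open>\<Prod>(1 - eps n) = 0\<close>, that \<open>\<Sum>(eps n) powr (3/2)\<close> converges (here \<open>q n ^ 6 = (eps n) powr (3/2)\<close>), and that
  \<open>hs (n + 1) / hs n\<close> is at most a small multiple of \<open>eps n\<close>.
\<close>

definition eps :: "nat \<Rightarrow> real" where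
  "eps n = 1 / (real n + 2)"

text \<open>This is the fourth root of \<open>eps n\<close>: the square root and the power 3/2 of
  \<open>eps n\<close> become the integer powers \<open>q n ^ 2\<close> and
  \<open>q n ^ 6\<close>.\<close>

definition q :: "nat \<Rightarrow> real" where
  "q n = (real n + 2) powr (-1/4)"

lemma eps_bounds: "0 < eps n" "eps n \<le> 1 / 2" "eps n \<le> 1"
  by (auto simp: eps_def field_simps)

lemma q_pos: "0 < q n"
  by (simp add: q_def)

lemma q_le_1: "q n \<le> 1"
  using powr_mono2'[of "-1/4" 1 "real n + 2"] by (simp add: q_def)

lemma q_pow_4: "q n ^ 4 = eps n"
proof -
  have "q n ^ 4 = (real n + 2) powr (-1)"
    unfolding q_def by (subst powr_power) auto
  then show ?thesis by (simp add: eps_def powr_minus_divide)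
qed

lemma summable_q_pow_6: "summable (\<lambda>n. q n ^ 6)"
proof -
  have "summable (\<lambda>n. real (n + 2) powr (-3/2))"
    by (subst summable_iff_shift) (simp add: summable_real_powr_iff)
  moreover have "q n ^ 6 = real (n + 2) powr (-3/2)" for n
    by (simp add: q_def powr_power add.commute)
  ultimately show ?thesis by simp
qed

text \<open>The ratio makes \<open>2 * hs (Suc n)\<close>, which bounds the distance within a cell
  of level \<open>n + 1\<close>, equal to \<open>hs n * eps n / 8\<close>. Treating such a cell as
  one line then costs no more than the side part does.\<close>

primrec hs :: "nat \<Rightarrow> real" where
  "hs 0 = 1"
| "hs (Suc n) = hs n * eps n / 16"

lemma hs_pos: "0 < hs n"
  by (induction n) (simp_all add: eps_bounds)

lemma hs_Suc_le: "hs (Suc n) \<le> hs n / 32"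
  using mult_left_mono[OF eps_bounds(2)[of n], of "hs n"] hs_pos[of n] by simp

lemma hs_add_le: "hs (n + k) \<le> hs n * (1/2)^k"
proof (induction k)
  case (Suc k)
  have "hs (n + Suc k) \<le> hs (n + k) / 32" using hs_Suc_le by simp
  also have "\<dots> \<le> hs n * (1/2)^Suc k" using Suc hs_pos[of "n + k"] by simp
  finally show ?case .
qed simp

lemma hs_tendsto_0: "hs \<longlonglongrightarrow> 0"
proof (rule tendsto_sandwich[OF _ _ tendsto_const])
  show "eventually (\<lambda>n. 0 \<le> hs n) sequentially" using hs_pos by (intro always_eventually) (auto intro: less_imp_le)
  show "eventually (\<lambda>n. hs n \<le> (1/2)^n) sequentially" using hs_add_le[of 0] by (intro always_eventually) simp
  show "(\<lambda>n. (1/2)^n :: real) \<longlonglongrightarrow> 0" by (intro LIMSEQ_power_zero) simp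
qed

section \<open>The coding of heights by digit sequences\<close>

definition Y :: "(nat \<Rightarrow> bool) \<Rightarrow> real" where
  "Y \<omega> = (\<Sum>n. of_bool (\<omega> n) * hs n)"

definition cyl :: "nat \<Rightarrow> (nat \<Rightarrow> bool) \<Rightarrow> (nat \<Rightarrow> bool) set" where
  "cyl n b = {\<omega>. \<forall>i<n. \<omega> i = b i}"

lemma summable_hs: "summable hs"
  by (rule summable_comparison_test'[of "\<lambda>n. (1/2)^n" 0])
    (use hs_add_le[of 0] hs_pos in \<open>auto simp: abs_of_pos\<close>)

lemma summable_Y: "summable (\<lambda>n. of_bool (\<omega> n) * hs n)"
  by (rule summable_comparison_test'[OF summable_hs, of 0])
    (use hs_pos in \<open>auto simp: less_imp_le\<close>)

lemma suminf_hs_shift_le: "(\<Sum>k. hs (k + n)) \<le> 2 * hs n"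
proof -
  have "(\<Sum>k. hs (k + n)) \<le> (\<Sum>k. hs n * (1/2)^k)"
    using hs_add_le[of n] summable_hs
    by (intro suminf_le) (auto simp: add.commute summable_iff_shift)
  also have "\<dots> = hs n * 2"
    by (subst suminf_mult) (auto simp: suminf_geometric)
  finally show ?thesis by simp
qed

text \<open>The first \<open>n\<close> digits cancel in the difference, and the remaining terms are
  dominated by the tail of \<open>hs\<close>.\<close>

lemma Y_cyl_dist:
  assumes "\<omega> \<in> cyl n b"
  shows "\<bar>Y \<omega> - Y b\<bar> \<le> 2 * hs n"
proof -
  define f where "f k = (of_bool (\<omega> k) - of_bool (b k)) * hs k" for k
  have sf: "summable f"
    unfolding f_def using summable_diff[OF summable_Y[of \<omega>] summable_Y[of b]]
    by (simp add: algebra_simps)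
  have "Y \<omega> - Y b = suminf f"
    unfolding f_def Y_def using suminf_diff[OF summable_Y[of \<omega>] summable_Y[of b]]
    by (simp add: algebra_simps)
  also have "\<dots> = (\<Sum>k. f (k + n)) + (\<Sum>k<n. f k)"
    by (rule suminf_split_initial_segment[OF sf])
  also have "(\<Sum>k<n. f k) = 0"
    using assms by (intro sum.neutral) (auto simp: f_def cyl_def)
  finally have "\<bar>Y \<omega> - Y b\<bar> = norm (\<Sum>k. f (k + n))" by simp
  also have "\<dots> \<le> (\<Sum>k. hs (k + n))"
    using summable_hs hs_pos
    by (intro norm_suminf_le) (auto simp: f_def less_imp_le summable_iff_shift)
  also have "\<dots> \<le> 2 * hs n" by (rule suminf_hs_shift_le)
  finally show ?thesis .
qed

lemma Y_upd: "Y (fun_upd \<omega> n True) = Y (fun_upd \<omega> n False) + hs n"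
proof -
  have "Y (fun_upd \<omega> n True) - Y (fun_upd \<omega> n False)
      = (\<Sum>k. of_bool ((fun_upd \<omega> n True) k) * hs k - of_bool ((fun_upd \<omega> n False) k) * hs k)"
    unfolding Y_def by (intro suminf_diff summable_Y)
  also have "\<dots> = (\<Sum>k\<in>{n}. of_bool ((fun_upd \<omega> n True) k) * hs k - of_bool ((fun_upd \<omega> n False) k) * hs k)"
    by (intro suminf_finite) auto
  finally show ?thesis by simp
qed

text \<open>Flipping digit \<open>n\<close> of \<open>b\<close> moves the height by exactly
  \<open>hs n\<close>, and the flipped sequence \<open>c\<close> shares \<open>n + 1\<close> digits
  with \<open>\<omega>\<close>.\<close>

lemma Y_first_diff:
  assumes "\<omega> \<in> cyl n b" "\<omega> n \<noteq> b n"
  shows "\<bar>Y \<omega> - Y b\<bar> \<ge> hs n - 2 * hs (Suc n)" "\<bar>Y \<omega> - Y b\<bar> \<le> hs n + 2 * hs (Suc n)"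
proof -
  define c where "c = fun_upd b n (\<omega> n)"
  have "\<omega> \<in> cyl (Suc n) c"
    using assms by (auto simp: cyl_def c_def less_Suc_eq)
  then have 1: "\<bar>Y \<omega> - Y c\<bar> \<le> 2 * hs (Suc n)" by (rule Y_cyl_dist)
  have 2: "\<bar>Y c - Y b\<bar> = hs n"
  proof (cases "\<omega> n")
    case True
    then have "fun_upd b n False = b" "c = fun_upd b n True" using assms by (auto simp: c_def intro!: fun_upd_idem)
    then show ?thesis using Y_upd[of b n] hs_pos[of n] by simp
  next
    case False
    then have "fun_upd b n True = b" "c = fun_upd b n False" using assms by (auto simp: c_def intro!: fun_upd_idem)
    then show ?thesis using Y_upd[of b n] hs_pos[of n] by simp
  qed
  show "\<bar>Y \<omega> - Y b\<bar> \<ge> hs n - 2 * hs (Suc n)" "\<bar>Y \<omega> - Y b\<bar> \<le> hs n + 2 * hs (Suc n)"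
    using 1 2 by linarith+
qed

text \<open>
  \<open>sep n\<close> is a lower bound for the distance of two points of the Cantor set whose digits first differ
  at a level at most \<open>n\<close>.
\<close>

definition sep :: "nat \<Rightarrow> real" where
  "sep n = hs n - 2 * hs (Suc n)"

lemma sep_bounds: "15 / 16 * hs n \<le> sep n" "sep n < hs n" "0 < sep n"
  using hs_Suc_le[of n] hs_pos[of n] hs_pos[of "Suc n"] by (simp_all add: sep_def del: hs.simps)

lemma sep_antimono: "m \<le> n \<Longrightarrow> sep n \<le> sep m"
proof (induction n rule: dec_induct)
  case (step n)
  then show ?case
    using sep_bounds(1)[of n] sep_bounds(2)[of "Suc n"] hs_Suc_le[of n] hs_pos[of n] by linarith
qed simp

lemma not_in_cyl_dist:
  assumes "\<omega> \<notin> cyl (Suc n) b"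
  shows "\<bar>Y \<omega> - Y b\<bar> \<ge> sep n"
proof -
  define j where "j = (LEAST j. \<omega> j \<noteq> b j)"
  obtain i where i: "i \<le> n" "\<omega> i \<noteq> b i" using assms by (auto simp: cyl_def less_Suc_eq_le)
  have j: "\<omega> j \<noteq> b j" unfolding j_def by (rule LeastI[of _ i]) (rule i)
  have "j \<le> n" unfolding j_def using i by (intro order_trans[OF Least_le[of _ i]]) auto
  have "\<omega> \<in> cyl j b" unfolding cyl_def j_def by (auto dest: not_less_Least)
  then have "sep j \<le> \<bar>Y \<omega> - Y b\<bar>" using Y_first_diff(1)[of \<omega> j b] j by (simp add: sep_def)
  then show ?thesis using sep_antimono[OF \<open>j \<le> n\<close>] by simp
qed

text \<open>The range of \<open>Y\<close> is closed. Approximants within \<open>sep n / 2\<close> of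
  \<open>y\<close> are less than \<open>sep n\<close> apart from each later, finer one, so their
  digits stabilize, and the diagonal sequence codes \<open>y\<close>.\<close>

lemma Y_closed_range:
  assumes "\<And>e. e > 0 \<Longrightarrow> \<exists>\<omega>. \<bar>Y \<omega> - y\<bar> < e"
  shows "\<exists>b. y = Y b"
proof -
  have "\<exists>\<omega>. \<bar>Y \<omega> - y\<bar> < sep n / 2" for n
    using assms[of "sep n / 2"] sep_bounds(3)[of n] by simp
  then obtain w where w: "\<And>n. \<bar>Y (w n) - y\<bar> < sep n / 2" by metis
  define b where "b n = w n n" for n
  have agree: "w m \<in> cyl (Suc n) (w n)" if "n \<le> m" for m n
  proof (rule ccontr)
    assume "\<not> ?thesis"
    then have "\<bar>Y (w m) - Y (w n)\<bar> \<ge> sep n" by (rule not_in_cyl_dist)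
    then show False using w[of m] w[of n] sep_antimono[OF that] by linarith
  qed
  have "w n \<in> cyl n b" for n
    using agree[of _ n] by (auto simp: cyl_def b_def)
  then have *: "\<bar>Y (w n) - Y b\<bar> \<le> 2 * hs n" for n by (rule Y_cyl_dist)
  have "\<bar>y - Y b\<bar> \<le> 3 * hs n" for n
    using *[of n] w[of n] sep_bounds(2)[of n] hs_pos[of n] by linarith
  moreover have "(\<lambda>n. 3 * hs n) \<longlonglongrightarrow> 3 * 0" by (intro tendsto_intros hs_tendsto_0)
  ultimately have "\<bar>y - Y b\<bar> \<le> 3 * 0"
    by (intro LIMSEQ_le_const[of "\<lambda>n. 3 * hs n"]) blast+
  then show ?thesis by auto
qed

section \<open>Independent digits and the masses of cylinders\<close>

definition coins :: "(nat \<Rightarrow> bool) measure" where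
  "coins = PiM UNIV (\<lambda>n. measure_pmf (bernoulli_pmf (eps n)))"

interpretation coin: product_prob_space "\<lambda>n. measure_pmf (bernoulli_pmf (eps n))" UNIV
  by unfold_locales

interpretation coins: prob_space coins
  unfolding coins_def by (rule coin.prob_space_axioms)

lemma space_coins [simp]: "space coins = UNIV"
  by (simp add: coins_def space_PiM)

lemma measurable_coin [measurable]: "(\<lambda>\<omega>. \<omega> n) \<in> coins \<rightarrow>\<^sub>M count_space UNIV"
proof -
  have "(\<lambda>\<omega>. \<omega> n) \<in> coins \<rightarrow>\<^sub>M measure_pmf (bernoulli_pmf (eps n))"
    unfolding coins_def by measurable
  then show ?thesis by (simp cong: measurable_cong_sets)
qed

lemma Y_measurable [measurable]: "Y \<in> borel_measurable coins"
  unfolding Y_def[abs_def] by measurable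

lemma cyl_sets [measurable]: "cyl n b \<in> sets coins"
proof -
  have "{\<omega> \<in> space coins. \<forall>i<n. \<omega> i = b i} \<in> sets coins" by measurable
  then show ?thesis by (simp add: cyl_def)
qed

lemma measure_cyl: "measure coins (cyl n b) = (\<Prod>i<n. if b i then eps i else 1 - eps i)"
proof -
  have "cyl n b = {\<omega> \<in> space coins. \<forall>i\<in>{..<n}. \<omega> i \<in> {b i}}"
    by (auto simp: cyl_def)
  also have "emeasure coins \<dots> = (\<Prod>i<n. emeasure (measure_pmf (bernoulli_pmf (eps i))) {b i})"
    unfolding coins_def by (rule coin.emeasure_PiM_Collect) auto
  also have "\<dots> = (\<Prod>i<n. ennreal (if b i then eps i else 1 - eps i))"
  proof (rule prod.cong[OF refl])
    fix i
    have "0 \<le> eps i" "eps i \<le> 1" using eps_bounds[of i] by auto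
    then show "emeasure (measure_pmf (bernoulli_pmf (eps i))) {b i} = ennreal (if b i then eps i else 1 - eps i)"
      by (cases "b i") (auto simp: emeasure_pmf_single)
  qed
  also have "\<dots> = ennreal (\<Prod>i<n. if b i then eps i else 1 - eps i)"
    using eps_bounds by (intro prod_ennreal) (auto simp: less_imp_le)
  finally show ?thesis
    using eps_bounds
    by (subst measure_eq_emeasure_eq_ennreal) (auto intro!: prod_nonneg simp: less_imp_le)
qed

lemma measure_cyl_Suc:
  "measure coins (cyl (Suc n) b) = measure coins (cyl n b) * (if b n then eps n else 1 - eps n)"
  by (simp add: measure_cyl)

lemma measure_cyl_pos: "0 < measure coins (cyl n b)"
  unfolding measure_cyl using eps_bounds by (intro prod_pos) (auto intro: le_less_trans[of _ "1/2"])

text \<open>Since \<open>eps n\<close> is at most 1/2, the main digit is the heavier one, and the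
  product of the factors \<open>1 - eps i = (i + 1) / (i + 2)\<close> telescopes. The decay to 0,
  uniform in \<open>b\<close>, reflects the divergence of the sum of \<open>eps\<close>.\<close>

lemma measure_cyl_le: "measure coins (cyl n b) \<le> 1 / (real n + 1)"
proof (induction n)
  case 0
  show ?case by (simp add: measure_cyl)
next
  case (Suc n)
  have "(if b n then eps n else 1 - eps n) \<le> 1 - eps n" using eps_bounds[of n] by auto
  then have "measure coins (cyl (Suc n) b) \<le> 1 / (real n + 1) * (1 - eps n)"
    unfolding measure_cyl_Suc using Suc eps_bounds[of n] by (intro mult_mono) auto
  also have "\<dots> = 1 / (real (Suc n) + 1)"
    by (simp add: eps_def field_simps)
  finally show ?case .
qed

text \<open>Two heights in the window differ by less than \<open>sep n\<close>, so the whole window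
  belongs to one cylinder.\<close>

lemma measure_Y_near_le:
  assumes "\<rho> < sep n / 2"
  shows "measure coins {\<omega>. \<bar>Y \<omega> - z\<bar> \<le> \<rho>} \<le> 1 / (real n + 1)"
proof (cases "{\<omega>. \<bar>Y \<omega> - z\<bar> \<le> \<rho>} = {}")
  case False
  then obtain b where b: "\<bar>Y b - z\<bar> \<le> \<rho>" by auto
  have "{\<omega>. \<bar>Y \<omega> - z\<bar> \<le> \<rho>} \<subseteq> cyl n b"
  proof clarify
    fix \<omega> assume "\<bar>Y \<omega> - z\<bar> \<le> \<rho>"
    then have "\<not> \<bar>Y \<omega> - Y b\<bar> \<ge> sep n" using b assms by linarith
    then have "\<omega> \<in> cyl (Suc n) b" using not_in_cyl_dist by blast
    then show "\<omega> \<in> cyl n b" by (auto simp: cyl_def)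
  qed
  then have "measure coins {\<omega>. \<bar>Y \<omega> - z\<bar> \<le> \<rho>} \<le> measure coins (cyl n b)"
    by (intro coins.finite_measure_mono) auto
  then show ?thesis using measure_cyl_le[of n b] by simp
qed (metis divide_nonneg_nonneg measure_empty of_nat_0_le_iff add_nonneg_nonneg zero_le_one)

section \<open>The product with Lebesgue measure\<close>

text \<open>Pushing forward from digit sequences, instead of from heights, lets every integral be
  split along cylinders.\<close>

definition mu :: "(real^2) measure" where
  "mu = distr (coins \<Otimes>\<^sub>M lborel) borel (\<lambda>(\<omega>, u). pt u (Y \<omega>))"

lemma sets_mu [simp, measurable_cong]: "sets mu = sets borel"
  by (simp add: mu_def)

lemma space_mu [simp]: "space mu = UNIV"
  by (simp add: mu_def)

lemma emeasure_mu:
  assumes [measurable]: "A \<in> sets borel"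
  shows "emeasure mu A = (\<integral>\<^sup>+\<omega>. emeasure lborel {u. pt u (Y \<omega>) \<in> A} \<partial>coins)"
proof -
  have "emeasure mu A = emeasure (coins \<Otimes>\<^sub>M lborel)
      ((\<lambda>(\<omega>, u). pt u (Y \<omega>)) -` A \<inter> space (coins \<Otimes>\<^sub>M lborel))"
    unfolding mu_def by (rule emeasure_distr) auto
  also have "\<dots> = (\<integral>\<^sup>+\<omega>. emeasure lborel
      (Pair \<omega> -` ((\<lambda>(\<omega>, u). pt u (Y \<omega>)) -` A \<inter> space (coins \<Otimes>\<^sub>M lborel))) \<partial>coins)"
    by (rule lborel.emeasure_pair_measure_alt) measurable
  finally show ?thesis
    by (simp add: vimage_def space_pair_measure)
qed

lemma pt_mem_ball_iff:
  assumes "r > 0"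
  shows "pt u s \<in> ball x r \<longleftrightarrow> (u - x $ 1)\<^sup>2 < r\<^sup>2 - (s - x $ 2)\<^sup>2"
proof -
  have "pt u s \<in> ball x r \<longleftrightarrow> sqrt ((u - x $ 1)\<^sup>2 + (s - x $ 2)\<^sup>2) < sqrt (r\<^sup>2)"
    using assms by (simp add: dist_real2 power2_commute)
  also have "\<dots> \<longleftrightarrow> (u - x $ 1)\<^sup>2 < r\<^sup>2 - (s - x $ 2)\<^sup>2"
    unfolding real_sqrt_less_iff by linarith
  finally show ?thesis .
qed

lemma emeasure_chord:
  assumes "r > 0"
  shows "emeasure lborel {u. pt u s \<in> ball x r} = ennreal (2 * sqrt (r\<^sup>2 - (s - x $ 2)\<^sup>2))"
proof (cases "r\<^sup>2 - (s - x $ 2)\<^sup>2 > 0")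
  case True
  define w where "w = sqrt (r\<^sup>2 - (s - x $ 2)\<^sup>2)"
  have w: "w > 0" "w\<^sup>2 = r\<^sup>2 - (s - x $ 2)\<^sup>2" using True by (auto simp: w_def)
  have "pt u s \<in> ball x r \<longleftrightarrow> u \<in> {x $ 1 - w<..<x $ 1 + w}" for u
  proof -
    have "pt u s \<in> ball x r \<longleftrightarrow> \<bar>u - x $ 1\<bar> < \<bar>w\<bar>"
      unfolding pt_mem_ball_iff[OF assms] w(2)[symmetric] by (simp add: abs_le_square_iff flip: not_le)
    then show ?thesis using w by auto
  qed
  then have "{u. pt u s \<in> ball x r} = {x $ 1 - w<..<x $ 1 + w}" by blast
  then show ?thesis using w by (simp flip: w_def)
next
  case False
  have "\<not> pt u s \<in> ball x r" for u
    using False zero_le_power2[of "u - x $ 1"] unfolding pt_mem_ball_iff[OF assms] by linarith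
  then have "{u. pt u s \<in> ball x r} = {}" by blast
  \<comment> \<open>\<open>sqrt\<close> of a negative real is negative, and \<open>ennreal\<close>
    truncates it to 0; the chord formula therefore also covers lines that miss the ball.\<close>
  moreover have "2 * sqrt (r\<^sup>2 - (s - x $ 2)\<^sup>2) \<le> 0" using False by simp
  ultimately show ?thesis by (metis emeasure_empty ennreal_neg)
qed

lemma emeasure_mu_ball:
  "r > 0 \<Longrightarrow> emeasure mu (ball x r) = (\<integral>\<^sup>+\<omega>. ennreal (2 * sqrt (r\<^sup>2 - (Y \<omega> - x $ 2)\<^sup>2)) \<partial>coins)"
  by (simp add: emeasure_mu emeasure_chord del: mem_ball)

text \<open>\<open>C\<close> is a family of lines that all cut the ball in chords of length at least
  \<open>w\<close>; it will be a cylinder.\<close>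

lemma emeasure_mu_ball_ge:
  assumes "r > 0" and [measurable]: "C \<in> sets coins"
    and w: "0 \<le> w" "\<And>\<omega>. \<omega> \<in> C \<Longrightarrow> w \<le> 2 * sqrt (r\<^sup>2 - (Y \<omega> - x $ 2)\<^sup>2)"
  shows "ennreal (w * measure coins C) \<le> emeasure mu (ball x r)"
proof -
  have "ennreal (w * measure coins C) = (\<integral>\<^sup>+\<omega>. ennreal w * indicator C \<omega> \<partial>coins)"
    using w(1) by (simp add: nn_integral_cmult_indicator coins.emeasure_eq_measure ennreal_mult)
  also have "\<dots> \<le> (\<integral>\<^sup>+\<omega>. ennreal (2 * sqrt (r\<^sup>2 - (Y \<omega> - x $ 2)\<^sup>2)) \<partial>coins)"
    using w(2) by (intro nn_integral_mono) (auto split: split_indicator intro: ennreal_leI)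
  finally show ?thesis using assms(1) by (simp add: emeasure_mu_ball)
qed

lemma abs_nth_le_dist: "\<bar>x $ i - y $ i\<bar> \<le> dist x y" for x y :: "real^2"
  using dist_vec_nth_le[of x i y] by (simp add: dist_real_def)

lemma emeasure_mu_cball_le:
  assumes "\<rho> > 0"
  shows "emeasure mu (cball z \<rho>) \<le> ennreal (2 * \<rho> * measure coins {\<omega>. \<bar>Y \<omega> - z $ 2\<bar> \<le> \<rho>})"
proof -
  have [measurable]: "{\<omega>. \<bar>Y \<omega> - z $ 2\<bar> \<le> \<rho>} \<in> sets coins"
  proof -
    have "{\<omega> \<in> space coins. \<bar>Y \<omega> - z $ 2\<bar> \<le> \<rho>} \<in> sets coins" by measurable
    then show ?thesis by simp
  qed
  have "emeasure lborel {u. pt u s \<in> cball z \<rho>} \<le> ennreal (2 * \<rho>) * of_bool (\<bar>s - z $ 2\<bar> \<le> \<rho>)" for s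
  proof (cases "\<bar>s - z $ 2\<bar> \<le> \<rho>")
    case True
    have "\<bar>z $ 1 - u\<bar> \<le> \<rho>" if "pt u s \<in> cball z \<rho>" for u
      using that abs_nth_le_dist[of z 1 "pt u s"] by simp
    then have "{u. pt u s \<in> cball z \<rho>} \<subseteq> {z $ 1 - \<rho>..z $ 1 + \<rho>}" by (force simp: abs_le_iff)
    then have "emeasure lborel {u. pt u s \<in> cball z \<rho>} \<le> emeasure lborel {z $ 1 - \<rho>..z $ 1 + \<rho>}"
      by (intro emeasure_mono) auto
    then show ?thesis using True assms by simp
  next
    case False
    have "\<not> pt u s \<in> cball z \<rho>" for u
      using False abs_nth_le_dist[of z 2 "pt u s"] by auto
    then have "{u. pt u s \<in> cball z \<rho>} = {}" by blast
    then show ?thesis by simp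
  qed
  then have "emeasure mu (cball z \<rho>) \<le> (\<integral>\<^sup>+\<omega>. ennreal (2 * \<rho>) * indicator {\<omega>. \<bar>Y \<omega> - z $ 2\<bar> \<le> \<rho>} \<omega> \<partial>coins)"
    by (subst emeasure_mu) (auto simp: indicator_def simp del: mem_cball intro!: nn_integral_mono)
  also have "\<dots> = ennreal (2 * \<rho> * measure coins {\<omega>. \<bar>Y \<omega> - z $ 2\<bar> \<le> \<rho>})"
    using assms by (simp add: nn_integral_cmult_indicator coins.emeasure_eq_measure ennreal_mult)
  finally show ?thesis .
qed

text \<open>A ball of radius \<open>\<rho>\<close> below \<open>sep n / 2\<close> meets lines of one
  level \<open>n\<close> cell only, so its mass is at most \<open>2 * \<rho> / (n + 1)\<close>,
  whatever its centre.\<close>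

lemma mu_small_balls:
  assumes "e > 0"
  shows "\<exists>\<rho>0>0. \<forall>z \<rho>. 0 < \<rho> \<and> \<rho> < \<rho>0 \<longrightarrow> emeasure mu (cball z \<rho>) \<le> ennreal (e * \<rho>)"
proof -
  obtain n :: nat where n: "2 / e < real n" using reals_Archimedean2 by blast
  then have n': "2 / (real n + 1) \<le> e" using assms by (simp add: field_simps)
  show ?thesis
  proof (intro exI[of _ "sep n / 2"] conjI allI impI)
    fix z :: "real^2" and \<rho> :: real assume \<rho>: "0 < \<rho> \<and> \<rho> < sep n / 2"
    have "2 * \<rho> * measure coins {\<omega>. \<bar>Y \<omega> - z $ 2\<bar> \<le> \<rho>} \<le> 2 * \<rho> * (1 / (real n + 1))"
      using \<rho> by (intro mult_left_mono measure_Y_near_le) auto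
    also have "\<dots> = \<rho> * (2 / (real n + 1))" by simp
    also have "\<dots> \<le> \<rho> * e" using \<rho> n' by (intro mult_left_mono) auto
    finally have "2 * \<rho> * measure coins {\<omega>. \<bar>Y \<omega> - z $ 2\<bar> \<le> \<rho>} \<le> e * \<rho>" by (simp only: mult.commute)
    then show "emeasure mu (cball z \<rho>) \<le> ennreal (e * \<rho>)"
      using emeasure_mu_cball_le[of \<rho> z] \<rho> by (metis ennreal_leI order_trans)
  qed (simp add: sep_bounds)
qed

lemma emeasure_mu_bounded_finite:
  assumes "bounded A"
  shows "emeasure mu A < \<infinity>"
proof -
  obtain R where R: "R > 0" "A \<subseteq> cball 0 R"
    using assms by (metis bounded_subset_ballD ball_subset_cball subset_trans)
  then have "emeasure mu A \<le> emeasure mu (cball 0 R)" by (intro emeasure_mono) auto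
  also have "\<dots> < \<infinity>" using emeasure_mu_cball_le[OF R(1), of 0] by (auto intro: le_less_trans)
  finally show ?thesis .
qed

lemma radon_mu: "radon_measure mu"
  by (rule radon_measure_locally_finite) (simp_all add: emeasure_mu_bounded_finite[simplified] compact_imp_bounded)

lemma emeasure_mu_UNIV: "emeasure mu UNIV = \<infinity>"
  by (simp add: emeasure_mu coins.emeasure_space_1[simplified])

lemma mu_density_tendsto_0: "((\<lambda>r. measure mu (ball x r) / r) \<longlongrightarrow> 0) (at_right 0)"
proof (rule tendstoI)
  fix e :: real assume "e > 0"
  then obtain \<rho>0 where \<rho>0: "\<rho>0 > 0"
      "\<And>z \<rho>. 0 < \<rho> \<Longrightarrow> \<rho> < \<rho>0 \<Longrightarrow> emeasure mu (cball z \<rho>) \<le> ennreal (e / 2 * \<rho>)"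
    using mu_small_balls[of "e / 2"] by auto
  have "dist (measure mu (ball x r) / r) 0 < e" if r: "0 < r" "r < \<rho>0" for r
  proof -
    have "emeasure mu (ball x r) \<le> emeasure mu (cball x r)" by (intro emeasure_mono) auto
    also have "\<dots> \<le> ennreal (e / 2 * r)" using r by (rule \<rho>0)
    finally have "measure mu (ball x r) \<le> e / 2 * r"
      using r \<open>e > 0\<close> unfolding measure_def by (intro enn2real_leI) auto
    then have "measure mu (ball x r) < e * r"
      using mult_pos_pos[OF \<open>e > 0\<close> r(1)] by linarith
    then show ?thesis using r(1) by (simp add: divide_less_eq)
  qed
  then show "eventually (\<lambda>r. dist (measure mu (ball x r) / r) 0 < e) (at_right 0)"
    using \<rho>0(1) by (auto simp: eventually_at_right_field)
qed

text \<open>Every Lipschitz curve is null by the uniform density bound. Countably many of them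
  together with a null complement would make the plane null, but its mass is infinite.\<close>

lemma not_rectifiable_mu: "\<not> rectifiable1 mu"
proof
  assume "rectifiable1 mu"
  then obtain \<gamma> :: "nat \<Rightarrow> real \<Rightarrow> real^2" where \<gamma>: "\<And>i. \<exists>C. C-lipschitz_on UNIV (\<gamma> i)"
    and null: "UNIV - (\<Union>i. range (\<gamma> i)) \<in> null_sets mu"
    unfolding rectifiable1_def by blast
  have "range (\<gamma> i) \<in> null_sets mu" for i
  proof -
    obtain C where "C-lipschitz_on UNIV (\<gamma> i)" using \<gamma> by metis
    then show ?thesis by (rule lipschitz_range_null[OF sets_mu _ mu_small_balls])
  qed
  then have N: "(\<Union>i. range (\<gamma> i)) \<in> null_sets mu" by (rule null_sets_UN)
  have "UNIV - A \<union> A = UNIV" for A :: "(real^2) set" by auto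
  with null_sets.Un[OF null N] have "UNIV \<in> null_sets mu" by metis
  then show False using emeasure_mu_UNIV by (auto dest: null_setsD1)
qed

text \<open>If no height \<open>Y \<omega>\<close> came within \<open>e\<close> of the height of
  \<open>x\<close>, all chords of \<open>ball x e\<close> would have length 0. So the height of
  \<open>x\<close> is a limit of values of \<open>Y\<close>, and the range is closed.\<close>

lemma measure_support_mu:
  assumes "x \<in> measure_support mu"
  shows "\<exists>b. x $ 2 = Y b"
proof (rule Y_closed_range)
  fix e :: real assume e: "e > 0"
  show "\<exists>\<omega>. \<bar>Y \<omega> - x $ 2\<bar> < e"
  proof (rule ccontr)
    assume *: "\<not> ?thesis"
    have "ennreal (2 * sqrt (e\<^sup>2 - (Y \<omega> - x $ 2)\<^sup>2)) = 0" for \<omega>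
    proof -
      have "e \<le> \<bar>Y \<omega> - x $ 2\<bar>" using * by (auto simp: not_less)
      then have "e\<^sup>2 \<le> \<bar>Y \<omega> - x $ 2\<bar>\<^sup>2" using e by (intro power_mono) auto
      then show ?thesis by (intro ennreal_neg) simp
    qed
    then have "emeasure mu (ball x e) = 0" using e by (simp add: emeasure_mu_ball)
    then show False using assms e by (auto simp: measure_support_def)
  qed
qed

section \<open>Test functions and a bound for the flat distance\<close>

lemma exists_sphere_point:
  fixes p x :: "'a::euclidean_space"
  assumes "dist x p \<le> r"
  shows "\<exists>z. dist x z = r \<and> dist p z = r - dist x p"
proof (cases "p = x")
  case True
  obtain e :: 'a where "norm e = 1" using vector_choose_size[of 1] by auto
  then show ?thesis
    using True assms by (intro exI[of _ "x + r *\<^sub>R e"]) (auto simp: dist_norm)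
next
  case False
  define d where "d = dist x p"
  have d: "d > 0" "norm (p - x) = d" using False by (auto simp: d_def dist_norm norm_minus_commute)
  define z where "z = x + (r / d) *\<^sub>R (p - x)"
  have "r \<ge> d" using assms by (simp add: d_def)
  have "dist x z = r" using d \<open>r \<ge> d\<close> by (simp add: z_def dist_norm)
  have "z - p = (r / d - 1) *\<^sub>R (p - x)" by (simp add: z_def algebra_simps)
  then have "dist p z = \<bar>r / d - 1\<bar> * d" by (simp add: dist_norm norm_minus_commute[of p z] d)
  moreover have "\<bar>r / d - 1\<bar> = r / d - 1" using d \<open>r \<ge> d\<close> by simp
  ultimately have "dist p z = r - d" using d by (simp add: left_diff_distrib)
  with \<open>dist x z = r\<close> show ?thesis by (auto simp: d_def)
qed

text \<open>The third part compares \<open>p\<close> with its radial projection to the sphere, where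
  the test function vanishes. It makes test functions small near the boundary of the ball.\<close>

lemma lip1_supportedD:
  assumes "\<phi> \<in> lip1_supported (ball x r)"
  shows "\<bar>\<phi> p - \<phi> p'\<bar> \<le> dist p p'"
    and "p \<notin> ball x r \<Longrightarrow> \<phi> p = 0"
    and "p \<in> ball x r \<Longrightarrow> \<bar>\<phi> p\<bar> \<le> r - dist x p"
    and "\<phi> \<in> borel_measurable borel"
proof -
  have lip: "1-lipschitz_on UNIV \<phi>" and cl: "closure {x. \<phi> x \<noteq> 0} \<subseteq> ball x r"
    using assms by (auto simp: lip1_supported_def)
  show *: "\<bar>\<phi> p - \<phi> p'\<bar> \<le> dist p p'" for p p'
    using lipschitz_onD[OF lip, of p p'] by (simp add: dist_real_def)
  show 0: "\<phi> p = 0" if "p \<notin> ball x r" for p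
  proof (rule ccontr)
    assume "\<phi> p \<noteq> 0"
    then have "p \<in> closure {x. \<phi> x \<noteq> 0}" by (intro subsetD[OF closure_subset]) simp
    then show False using cl that by auto
  qed
  show "\<bar>\<phi> p\<bar> \<le> r - dist x p" if p: "p \<in> ball x r"
  proof -
    obtain z where z: "dist x z = r" "dist p z = r - dist x p"
      using exists_sphere_point[of x p r] p by auto
    have "\<phi> z = 0" using z(1) by (intro 0) simp
    then show ?thesis using *[of p z] z(2) by simp
  qed
  show "\<phi> \<in> borel_measurable borel"
    using lipschitz_on_continuous_on[OF lip] by (rule borel_measurable_continuous_onI)
qed

text \<open>The lines in \<open>C\<close> are moved vertically onto the line at height
  \<open>y\<close>, at a cost of \<open>\<bar>Y \<omega> - y\<bar>\<close> per unit length over a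
  window of length \<open>2 * r\<close>. The other lines are not compared with anything; each costs
  its chord length times the bound on test functions at its distance from the centre.\<close>

lemma flat_dist_mu_le:
  assumes r: "r > 0" and C[measurable]: "C \<in> sets coins"
  shows "flat_dist (ball x r) mu (flat_measure (measure coins C) (hline y))
    \<le> (\<integral>\<^sup>+\<omega>. (if \<omega> \<in> C then ennreal (2 * r * \<bar>Y \<omega> - y\<bar>)
          else ennreal (r - \<bar>Y \<omega> - x $ 2\<bar>) * ennreal (2 * sqrt (r\<^sup>2 - (Y \<omega> - x $ 2)\<^sup>2))) \<partial>coins)"
  unfolding flat_dist_def
proof (rule SUP_least)
  fix \<phi> assume \<phi>: "\<phi> \<in> lip1_supported (ball x r)"
  note lip = lip1_supportedD(1)[OF \<phi>] and zero = lip1_supportedD(2)[OF \<phi>]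
    and bnd = lip1_supportedD(3)[OF \<phi>] and [measurable] = lip1_supportedD(4)[OF \<phi>]
  \<comment> \<open>All values of the test function vanish for \<open>u\<close> outside
    \<open>I\<close>, which gives integrability although the product measure is infinite.\<close>
  define I where "I = {x $ 1 - r..x $ 1 + r}"
  have zeroI: "\<phi> (pt u s) = 0" if "u \<notin> I" for u s
  proof (rule zero)
    show "pt u s \<notin> ball x r"
      using that abs_nth_le_dist[of x 1 "pt u s"] by (auto simp: I_def abs_le_iff)
  qed
  have bndr: "\<bar>\<phi> p\<bar> \<le> r" for p
    using bnd[of p] zero[of p] r zero_le_dist[of x p] by (cases "p \<in> ball x r") (auto simp del: zero_le_dist)
  let ?M = "coins \<Otimes>\<^sub>M (lborel :: real measure)"
  define f where "f = (\<lambda>(\<omega>, u). \<phi> (pt u (Y \<omega>)))"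
  \<comment> \<open>The line of density \<open>measure coins C\<close> is spread over the sequences
    in \<open>C\<close>, so both integrals live on one product space and can be subtracted
    pointwise.\<close>
  define g where "g = (\<lambda>(\<omega>, u). indicator C \<omega> * \<phi> (pt u y) :: real)"
  have [measurable]: "f \<in> borel_measurable ?M" "g \<in> borel_measurable ?M"
    unfolding f_def g_def by measurable
  have A[measurable]: "UNIV \<times> I \<in> sets ?M"
    using pair_measureI[of UNIV coins I lborel] sets.top[of coins] by (simp add: I_def)
  have finA: "emeasure ?M (UNIV \<times> I) < \<infinity>"
    using lborel.emeasure_pair_measure_Times[of UNIV coins I] sets.top[of coins] coins.emeasure_space_1 r
    by (simp add: I_def)
  have int: "integrable ?M f" "integrable ?M g"
    using bndr zeroI r
    by (intro integrableI_bounded_set[OF A _ finA, of _ r] AE_I2; force simp: f_def g_def split_beta indicator_def)+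
  interpret P: pair_sigma_finite coins "lborel :: real measure" ..
  have "(\<integral>z. \<phi> z \<partial>mu) = integral\<^sup>L ?M f"
    unfolding mu_def f_def by (subst integral_distr) (auto intro!: Bochner_Integration.integral_cong)
  moreover have "(\<integral>z. \<phi> z \<partial>flat_measure (measure coins C) (hline y)) = integral\<^sup>L ?M g"
  proof -
    have "integral\<^sup>L ?M g = (\<integral>\<omega>. (\<integral>u. indicator C \<omega> * \<phi> (pt u y) \<partial>lborel) \<partial>coins)"
      using P.integral_fst'[OF int(2)] by (simp add: g_def)
    also have "\<dots> = measure coins C * (\<integral>u. \<phi> (pt u y) \<partial>lborel)"
      by simp
    finally show ?thesis by (simp add: integral_flat_measure_hline)
  qed
  ultimately have "ennreal \<bar>(\<integral>z. \<phi> z \<partial>mu) - (\<integral>z. \<phi> z \<partial>flat_measure (measure coins C) (hline y))\<bar>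
      = ennreal (norm (\<integral>z. f z - g z \<partial>?M))"
    using int by simp
  also have "\<dots> \<le> (\<integral>\<^sup>+z. ennreal (norm (f z - g z)) \<partial>?M)"
    using int by (intro integral_norm_bound_ennreal) auto
  also have "\<dots> = (\<integral>\<^sup>+\<omega>. (\<integral>\<^sup>+u. ennreal (norm (f (\<omega>, u) - g (\<omega>, u))) \<partial>lborel) \<partial>coins)"
    by (rule lborel.nn_integral_fst[symmetric]) measurable
  also have "\<dots> \<le> (\<integral>\<^sup>+\<omega>. (if \<omega> \<in> C then ennreal (2 * r * \<bar>Y \<omega> - y\<bar>)
          else ennreal (r - \<bar>Y \<omega> - x $ 2\<bar>) * ennreal (2 * sqrt (r\<^sup>2 - (Y \<omega> - x $ 2)\<^sup>2))) \<partial>coins)"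
  proof (rule nn_integral_mono)
    fix \<omega>
    show "(\<integral>\<^sup>+u. ennreal (norm (f (\<omega>, u) - g (\<omega>, u))) \<partial>lborel) \<le> (if \<omega> \<in> C then ennreal (2 * r * \<bar>Y \<omega> - y\<bar>)
          else ennreal (r - \<bar>Y \<omega> - x $ 2\<bar>) * ennreal (2 * sqrt (r\<^sup>2 - (Y \<omega> - x $ 2)\<^sup>2)))"
    proof (cases "\<omega> \<in> C")
      case True
      have "ennreal (norm (f (\<omega>, u) - g (\<omega>, u))) \<le> ennreal \<bar>Y \<omega> - y\<bar> * indicator I u" for u
        using True lip[of "pt u (Y \<omega>)" "pt u y"] zeroI[of u]
        by (cases "u \<in> I") (auto simp: f_def g_def dist_pt intro!: ennreal_leI)
      then have "(\<integral>\<^sup>+u. ennreal (norm (f (\<omega>, u) - g (\<omega>, u))) \<partial>lborel)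
          \<le> (\<integral>\<^sup>+u. ennreal \<bar>Y \<omega> - y\<bar> * indicator I u \<partial>lborel)"
        by (rule nn_integral_mono)
      also have "\<dots> = ennreal \<bar>Y \<omega> - y\<bar> * ennreal (2 * r)"
        using r by (simp add: nn_integral_cmult_indicator I_def)
      finally show ?thesis using True r by (simp add: ennreal_mult[symmetric] mult.commute)
    next
      case False
      have *: "ennreal (norm (f (\<omega>, u) - g (\<omega>, u)))
          \<le> ennreal (r - \<bar>Y \<omega> - x $ 2\<bar>) * indicator {u. pt u (Y \<omega>) \<in> ball x r} u" for u
      proof (cases "pt u (Y \<omega>) \<in> ball x r")
        case True
        have "\<bar>\<phi> (pt u (Y \<omega>))\<bar> \<le> r - \<bar>Y \<omega> - x $ 2\<bar>"
          using bnd[OF True] abs_nth_le_dist[of x 2 "pt u (Y \<omega>)"] by simp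
        then show ?thesis using True False by (simp add: f_def g_def ennreal_leI del: mem_ball)
      next
        case 2: False
        then show ?thesis using False zero[OF 2] by (simp add: f_def g_def)
      qed
      have m: "{u. pt u (Y \<omega>) \<in> ball x r} \<in> sets borel"
      proof -
        have "(\<lambda>u. pt u (Y \<omega>)) \<in> borel_measurable borel" by measurable
        from measurable_sets[OF this, of "ball x r"] show ?thesis by (simp add: vimage_def)
      qed
      have "(\<integral>\<^sup>+u. ennreal (norm (f (\<omega>, u) - g (\<omega>, u))) \<partial>lborel)
          \<le> (\<integral>\<^sup>+u. ennreal (r - \<bar>Y \<omega> - x $ 2\<bar>) * indicator {u. pt u (Y \<omega>) \<in> ball x r} u \<partial>lborel)"
        by (intro nn_integral_mono *)
      also have "\<dots> = ennreal (r - \<bar>Y \<omega> - x $ 2\<bar>) * ennreal (2 * sqrt (r\<^sup>2 - (Y \<omega> - x $ 2)\<^sup>2))"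
        using r by (subst nn_integral_cmult_indicator) (simp_all add: emeasure_chord m del: mem_ball)
      finally show ?thesis using False by simp
    qed
  qed
  finally show "ennreal \<bar>(\<integral>z. \<phi> z \<partial>mu) - (\<integral>z. \<phi> z \<partial>flat_measure (measure coins C) (hline y))\<bar>
    \<le> (\<integral>\<^sup>+\<omega>. (if \<omega> \<in> C then ennreal (2 * r * \<bar>Y \<omega> - y\<bar>)
          else ennreal (r - \<bar>Y \<omega> - x $ 2\<bar>) * ennreal (2 * sqrt (r\<^sup>2 - (Y \<omega> - x $ 2)\<^sup>2))) \<partial>coins)" .
qed

text \<open>One pair \<open>c\<close>, \<open>L\<close> bounds the infimum. The number
  \<open>\<kappa>\<close> is a flat distance per unit of mass, so the mass of the ball cancels once
  it is positive and finite.\<close>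

lemma alpha1_le:
  fixes \<mu> :: "'a::euclidean_space measure"
  assumes "r > 0" "c \<ge> 0" "L \<in> lines" "\<kappa> \<ge> 0"
    and M: "0 < emeasure \<mu> (ball x r)" "emeasure \<mu> (ball x r) < \<infinity>"
    and le: "flat_dist (ball x r) \<mu> (flat_measure c L) \<le> ennreal \<kappa> * emeasure \<mu> (ball x r)"
  shows "alpha1 \<mu> x r \<le> ennreal (\<kappa> / r)"
proof -
  obtain m where m: "emeasure \<mu> (ball x r) = ennreal m" "m > 0"
    using M by (cases "emeasure \<mu> (ball x r)") (auto simp: ennreal_less_zero_iff)
  have "(INF c\<in>{0..}. INF L\<in>lines. flat_dist (ball x r) \<mu> (flat_measure c L))
      \<le> flat_dist (ball x r) \<mu> (flat_measure c L)"
    using assms(2,3) by (intro INF_lower2[of c] INF_lower) auto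
  also have "\<dots> \<le> ennreal (\<kappa> * m)" using le m \<open>\<kappa> \<ge> 0\<close> by (simp add: ennreal_mult)
  finally have "alpha1 \<mu> x r \<le> ennreal (\<kappa> * m) / (ennreal r * ennreal m)"
    unfolding alpha1_def m(1) by (rule divide_right_mono_ennreal)
  also have "\<dots> = ennreal (\<kappa> / r)"
    using m assms by (simp add: ennreal_mult[symmetric] divide_ennreal)
  finally show ?thesis .
qed

section \<open>The size of the coefficients\<close>

lemma cyl_upd [simp]: "cyl m (fun_upd b m v) = cyl m b"
  by (auto simp: cyl_def)

lemma cyl_SucI: "\<omega> \<in> cyl m b \<Longrightarrow> \<omega> \<in> cyl (Suc m) (fun_upd b m (\<omega> m))"
  by (auto simp: cyl_def less_Suc_eq)

lemma cyl_SucD: "\<omega> \<in> cyl (Suc m) b \<Longrightarrow> \<omega> \<in> cyl m b \<and> \<omega> m = b m"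
  by (auto simp: cyl_def)

text \<open>Lines from other cells of level \<open>m\<close> do not meet the open ball. At level 0
  there are no other cells.\<close>

lemma far_outside_cyl:
  assumes "m = 0 \<or> r \<le> sep (m - 1)" "\<omega> \<notin> cyl m b"
  shows "r \<le> \<bar>Y \<omega> - Y b\<bar>"
proof (cases m)
  case 0
  then show ?thesis using assms(2) by (simp add: cyl_def)
next
  case (Suc k)
  then show ?thesis using assms not_in_cyl_dist[of \<omega> k b] by simp
qed

lemma chord_ge:
  assumes "\<bar>t\<bar> \<le> T" "0 \<le> w" "w\<^sup>2 \<le> 4 * (r\<^sup>2 - T\<^sup>2)"
  shows "w \<le> 2 * sqrt (r\<^sup>2 - t\<^sup>2)"
proof -
  have "t\<^sup>2 \<le> T\<^sup>2" using assms(1) by (metis abs_ge_zero power2_abs power_mono)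
  then have "(w / 2)\<^sup>2 \<le> r\<^sup>2 - t\<^sup>2" using assms(3) by (simp add: power_divide)
  then have "w / 2 \<le> sqrt (r\<^sup>2 - t\<^sup>2)" by (rule real_le_rsqrt)
  then show ?thesis by simp
qed

text \<open>The ratio 3/5 leaves room for a line at distance \<open>17/16 * hs m\<close> when
  \<open>2 * hs m\<close> is at most \<open>r\<close>.\<close>

lemma chord_ge_radius:
  assumes "\<bar>t\<bar> \<le> 3 / 5 * r"
  shows "r \<le> 2 * sqrt (r\<^sup>2 - t\<^sup>2)"
proof (rule chord_ge[OF assms])
  show "0 \<le> r" using assms by linarith
  show "r\<^sup>2 \<le> 4 * (r\<^sup>2 - (3 / 5 * r)\<^sup>2)"
    using zero_le_power2[of r] by (simp only: power_mult_distrib) (simp add: power_divide)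
qed

lemma nn_integral_le_two_sets:
  assumes [measurable]: "A \<in> sets coins" "B \<in> sets coins" and "0 \<le> a" "0 \<le> c"
    and "\<And>\<omega>. f \<omega> \<le> ennreal a * indicator A \<omega> + ennreal c * indicator B \<omega>"
  shows "(\<integral>\<^sup>+\<omega>. f \<omega> \<partial>coins) \<le> ennreal (a * measure coins A + c * measure coins B)"
proof -
  have "(\<integral>\<^sup>+\<omega>. f \<omega> \<partial>coins) \<le> (\<integral>\<^sup>+\<omega>. ennreal a * indicator A \<omega> + ennreal c * indicator B \<omega> \<partial>coins)"
    using assms by (intro nn_integral_mono)
  also have "\<dots> = ennreal a * emeasure coins A + ennreal c * emeasure coins B"
    by (simp add: nn_integral_add nn_integral_cmult_indicator)
  also have "\<dots> = ennreal (a * measure coins A + c * measure coins B)"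
    using assms by (simp add: coins.emeasure_eq_measure ennreal_mult)
  finally show ?thesis .
qed

lemma two_hs_Suc: "2 * hs (Suc m) = hs m * eps m / 8"
  by simp

lemma sep_eq: "sep m = hs m - hs m * eps m / 8"
  by (simp add: sep_def)

lemma hs_eps_le: "hs m * eps m / 8 \<le> hs m / 16"
  using mult_left_mono[OF eps_bounds(2)[of m], of "hs m"] hs_pos[of m] by simp

text \<open>
  For \<open>sep m \<le> r \<le> sep (m - 1)\<close> the ball sees only the level \<open>m\<close> cell of its centre. Putting the whole
  weight of the cell on a line through the main part costs only the weight of the side part.
\<close>

lemma alpha1_main:
  assumes y: "x $ 2 = Y b" and near: "m = 0 \<or> r \<le> sep (m - 1)" and sep: "sep m \<le> r"
    and far: "\<not> b m \<or> 2 * hs m \<le> r"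
  shows "alpha1 mu x r \<le> ennreal (9 * hs m * eps m / r)"
proof -
  define h e p where "h = hs m" and "e = eps m" and "p = measure coins (cyl m b)"
  have h: "h > 0" and e: "0 < e" "e \<le> 1 / 2" and p: "p > 0"
    using eps_bounds[of m] by (simp_all add: h_def e_def p_def hs_pos measure_cyl_pos)
  have he: "h * e / 8 \<le> h / 16" using hs_eps_le by (simp add: h_def e_def)
  have r: "r > 0" "15 / 16 * h \<le> r"
    using sep sep_bounds[of m] by (auto simp: h_def)
  \<comment> \<open>These code the main and the side part of the cell, whichever of the two contains
    the centre.\<close>
  define c d where "c = fun_upd b m False" and "d = fun_upd b m True"
  have P: "measure coins (cyl (Suc m) c) = p * (1 - e)" "measure coins (cyl (Suc m) d) = p * e"
    by (simp_all add: measure_cyl_Suc c_def d_def p_def e_def)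
  have "ennreal (r * measure coins (cyl (Suc m) c)) \<le> emeasure mu (ball x r)"
  proof (rule emeasure_mu_ball_ge)
    fix \<omega> assume \<omega>: "\<omega> \<in> cyl (Suc m) c"
    have "\<bar>Y \<omega> - Y b\<bar> \<le> 3 / 5 * r"
    proof (cases "b m")
      case False
      then have "c = b" by (auto simp: c_def intro!: fun_upd_idem)
      then show ?thesis using Y_cyl_dist[OF \<omega>] he r two_hs_Suc[of m] by (simp only: h_def e_def)
    next
      case True
      then have "2 * h \<le> r" using far by (simp add: h_def)
      have "\<omega> \<in> cyl m b" "\<omega> m \<noteq> b m" using True cyl_SucD[OF \<omega>] by (auto simp: c_def)
      from Y_first_diff(2)[OF this] show ?thesis
        using he \<open>2 * h \<le> r\<close> h two_hs_Suc[of m] unfolding h_def e_def by linarith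
    qed
    then show "r \<le> 2 * sqrt (r\<^sup>2 - (Y \<omega> - x $ 2)\<^sup>2)"
      unfolding y by (rule chord_ge_radius)
  qed (use r in auto)
  then have mu_ge: "ennreal (r * (p * (1 - e))) \<le> emeasure mu (ball x r)" by (simp add: P)
  \<comment> \<open>The first term is the thickness of the main part; the second moves the side part
    by at most \<open>2 * h\<close> onto the line.\<close>
  have "flat_dist (ball x r) mu (flat_measure (measure coins (cyl m b)) (hline (Y c)))
      \<le> ennreal (2 * r * (h * e / 8) * measure coins (cyl (Suc m) c) + 4 * r * h * measure coins (cyl (Suc m) d))"
  proof (rule order_trans[OF flat_dist_mu_le[OF r(1) cyl_sets]], rule nn_integral_le_two_sets)
    fix \<omega>
    show "(if \<omega> \<in> cyl m b then ennreal (2 * r * \<bar>Y \<omega> - Y c\<bar>)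
          else ennreal (r - \<bar>Y \<omega> - x $ 2\<bar>) * ennreal (2 * sqrt (r\<^sup>2 - (Y \<omega> - x $ 2)\<^sup>2)))
        \<le> ennreal (2 * r * (h * e / 8)) * indicator (cyl (Suc m) c) \<omega>
          + ennreal (4 * r * h) * indicator (cyl (Suc m) d) \<omega>"
    proof (cases "\<omega> \<in> cyl m b")
      case False
      then have "r - \<bar>Y \<omega> - x $ 2\<bar> \<le> 0" using far_outside_cyl[OF near] y by simp
      then show ?thesis using False by (simp add: ennreal_neg)
    next
      case in_cyl: True
      show ?thesis
      proof (cases "\<omega> m")
        case False
        then have \<omega>: "\<omega> \<in> cyl (Suc m) c" using cyl_SucI[OF in_cyl] by (simp add: c_def)
        have "2 * r * \<bar>Y \<omega> - Y c\<bar> \<le> 2 * r * (h * e / 8)"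
          using Y_cyl_dist[OF \<omega>] r two_hs_Suc[of m] by (intro mult_left_mono) (simp_all add: h_def e_def mult.commute)
        then show ?thesis using in_cyl \<omega> by (auto intro!: ennreal_leI add_increasing2)
      next
        case True
        then have \<omega>: "\<omega> \<in> cyl (Suc m) d" using cyl_SucI[OF in_cyl] by (simp add: d_def)
        have "\<omega> \<in> cyl m c" "\<omega> m \<noteq> c m" using in_cyl True by (auto simp: c_def)
        from Y_first_diff(2)[OF this] have "\<bar>Y \<omega> - Y c\<bar> \<le> 2 * h"
          using he h two_hs_Suc[of m] by (simp only: h_def e_def)
        then have "2 * r * \<bar>Y \<omega> - Y c\<bar> \<le> 2 * r * (2 * h)" using r by (intro mult_left_mono) auto
        then show ?thesis using in_cyl \<omega> by (auto intro!: ennreal_leI add_increasing)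
      qed
    qed
  qed (use r h e in auto)
  also have "\<dots> \<le> ennreal (9 * h * e * (r * (p * (1 - e))))"
  proof (rule ennreal_leI)
    \<comment> \<open>The worst case is \<open>e = 1/2\<close>, where the factors are 4.125 and
      4.5.\<close>
    have "(r * p * h * e) * ((1 - e) / 4 + 4) \<le> (r * p * h * e) * (9 * (1 - e))"
      using r h e p by (intro mult_left_mono) auto
    then show "2 * r * (h * e / 8) * measure coins (cyl (Suc m) c) + 4 * r * h * measure coins (cyl (Suc m) d)
        \<le> 9 * h * e * (r * (p * (1 - e)))"
      unfolding P by (simp add: algebra_simps)
  qed
  also have "\<dots> = ennreal (9 * h * e) * ennreal (r * (p * (1 - e)))"
    using h e r p by (intro ennreal_mult) auto
  also have "\<dots> \<le> ennreal (9 * h * e) * emeasure mu (ball x r)"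
    by (intro mult_left_mono mu_ge) auto
  finally have "alpha1 mu x r \<le> ennreal (9 * h * e / r)"
    using r h e p mu_ge
    by (intro alpha1_le[OF r(1) _ hline_in_lines])
      (auto intro: less_le_trans[rotated] emeasure_mu_bounded_finite[simplified])
  then show ?thesis by (simp add: h_def e_def)
qed

text \<open>
  The main part has just entered the ball, so it lies near the boundary, where test functions are at
  most \<open>r - sep m\<close>. Its contribution is therefore small relative to \<open>\<mu> (ball x r)\<close>, and the line through
  the side part itself is good enough.
\<close>

lemma alpha1_side_small:
  assumes y: "x $ 2 = Y b" and sep: "sep m \<le> r" and small: "r \<le> hs m * (1 + (q m)\<^sup>2)"
  shows "alpha1 mu x r \<le> ennreal (2 * (q m)\<^sup>2)"
proof -
  define h e k where "h = hs m" and "e = eps m" and "k = (q m)\<^sup>2"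
  have h: "h > 0" and e: "0 < e" "e \<le> 1 / 2"
    using eps_bounds[of m] by (simp_all add: h_def e_def hs_pos)
  have k: "0 < k" "k \<le> 1" "e \<le> k"
  proof -
    show "0 < k" using q_pos[of m] by (simp add: k_def)
    show "k \<le> 1" using q_pos[of m] q_le_1[of m] by (simp add: k_def power_le_one)
    have "e = k * k" unfolding e_def k_def q_pow_4[symmetric] by (simp add: power_numeral_reduce)
    then show "e \<le> k" using \<open>0 < k\<close> \<open>k \<le> 1\<close> mult_left_mono[of k 1 k] by simp
  qed
  have he: "h * e / 8 \<le> h / 16" "h * e \<le> h * k"
    using hs_eps_le h k by (simp_all add: h_def e_def mult.commute)
  have r: "r > 0" "15 / 16 * h \<le> r" "sep m = h - h * e / 8" "r \<le> h + h * k"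
    using sep sep_bounds[of m] sep_eq[of m] small by (auto simp: h_def e_def k_def algebra_simps)
  have "ennreal (r * measure coins (cyl (Suc m) b)) \<le> emeasure mu (ball x r)"
  proof (rule emeasure_mu_ball_ge)
    fix \<omega> assume "\<omega> \<in> cyl (Suc m) b"
    from Y_cyl_dist[OF this] have "\<bar>Y \<omega> - Y b\<bar> \<le> 3 / 5 * r"
      using he(1) r two_hs_Suc[of m] by (simp only: h_def e_def)
    then show "r \<le> 2 * sqrt (r\<^sup>2 - (Y \<omega> - x $ 2)\<^sup>2)"
      unfolding y by (rule chord_ge_radius)
  qed (use r in auto)
  then have mu_ge: "ennreal (r * measure coins (cyl (Suc m) b)) \<le> emeasure mu (ball x r)" .
  have mu_pos: "0 < emeasure mu (ball x r)"
    using r measure_cyl_pos[of "Suc m" b] by (intro less_le_trans[OF _ mu_ge]) simp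
  \<comment> \<open>The bound \<open>r - sep m\<close> is charged to every chord, also to those of
    the cylinder, so that the second term integrates exactly to \<open>r - sep m\<close> times the
    mass of the ball.\<close>
  have "flat_dist (ball x r) mu (flat_measure (measure coins (cyl (Suc m) b)) (hline (Y b)))
      \<le> (\<integral>\<^sup>+\<omega>. ennreal (2 * r * (h * e / 8)) * indicator (cyl (Suc m) b) \<omega>
          + ennreal (r - sep m) * ennreal (2 * sqrt (r\<^sup>2 - (Y \<omega> - x $ 2)\<^sup>2)) \<partial>coins)"
  proof (rule order_trans[OF flat_dist_mu_le[OF r(1) cyl_sets]], rule nn_integral_mono)
    fix \<omega>
    show "(if \<omega> \<in> cyl (Suc m) b then ennreal (2 * r * \<bar>Y \<omega> - Y b\<bar>)
          else ennreal (r - \<bar>Y \<omega> - x $ 2\<bar>) * ennreal (2 * sqrt (r\<^sup>2 - (Y \<omega> - x $ 2)\<^sup>2)))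
        \<le> ennreal (2 * r * (h * e / 8)) * indicator (cyl (Suc m) b) \<omega>
          + ennreal (r - sep m) * ennreal (2 * sqrt (r\<^sup>2 - (Y \<omega> - x $ 2)\<^sup>2))"
    proof (cases "\<omega> \<in> cyl (Suc m) b")
      case True
      have "2 * r * \<bar>Y \<omega> - Y b\<bar> \<le> 2 * r * (h * e / 8)"
        using Y_cyl_dist[OF True] r two_hs_Suc[of m] by (intro mult_left_mono) (simp_all add: h_def e_def mult.commute)
      then show ?thesis using True by (auto intro!: ennreal_leI add_increasing2)
    next
      case False
      then have "r - \<bar>Y \<omega> - x $ 2\<bar> \<le> r - sep m" using not_in_cyl_dist[OF False] y by simp
      then show ?thesis using False by (auto intro!: mult_right_mono ennreal_leI)
    qed
  qed
  also have "\<dots> = ennreal (2 * r * (h * e / 8)) * emeasure coins (cyl (Suc m) b)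
      + ennreal (r - sep m) * emeasure mu (ball x r)"
    using r(1) by (simp add: nn_integral_add nn_integral_cmult nn_integral_cmult_indicator emeasure_mu_ball)
  also have "ennreal (2 * r * (h * e / 8)) * emeasure coins (cyl (Suc m) b)
      = ennreal (h * e / 4) * ennreal (r * measure coins (cyl (Suc m) b))"
    using r h e by (simp add: coins.emeasure_eq_measure ac_simps flip: ennreal_mult)
  also have "\<dots> + ennreal (r - sep m) * emeasure mu (ball x r)
      \<le> ennreal (h * e / 4) * emeasure mu (ball x r) + ennreal (r - sep m) * emeasure mu (ball x r)"
    by (intro add_right_mono mult_left_mono mu_ge) auto
  also have "\<dots> = ennreal (h * e / 4 + (r - sep m)) * emeasure mu (ball x r)"
    using h e sep by (simp add: distrib_right)
  finally have "alpha1 mu x r \<le> ennreal ((h * e / 4 + (r - sep m)) / r)"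
    using h e sep mu_pos
    by (intro alpha1_le[OF r(1) _ hline_in_lines]) (auto intro: emeasure_mu_bounded_finite[simplified])
  also have "\<dots> \<le> ennreal (2 * k)"
  proof (rule ennreal_leI)
    \<comment> \<open>Inserting \<open>sep m = h - h * e / 8\<close> leaves
      \<open>3/8 * (h * e) + h * k\<close>, and \<open>e\<close> is at most
      \<open>k\<close>.\<close>
    have "h * e / 4 + (r - sep m) \<le> 11 / 8 * (h * k)" using r he by linarith
    also have "\<dots> \<le> 2 * k * r"
    proof -
      have "15 / 16 * (h * k) \<le> k * r" using mult_left_mono[OF r(2), of k] k(1) by (simp add: mult_ac)
      then show ?thesis using mult_pos_pos[OF h k(1)] by linarith
    qed
    finally show "(h * e / 4 + (r - sep m)) / r \<le> 2 * k" using r(1) by (simp add: pos_divide_le_eq)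
  qed
  finally show ?thesis by (simp add: k_def)
qed

text \<open>
  By now the chord cut out of the main part has length at least \<open>2 * hs m * q m\<close>, which makes the main
  part outweigh the side part by a factor of order \<open>q m / eps m = 1 / q m ^ 3\<close>.
\<close>

lemma alpha1_side_large:
  assumes y: "x $ 2 = Y b" and near: "m = 0 \<or> r \<le> sep (m - 1)" and "b m"
    and large: "hs m * (1 + (q m)\<^sup>2) \<le> r" and le: "r \<le> 2 * hs m"
  shows "alpha1 mu x r \<le> ennreal (5 * q m ^ 3)"
proof -
  define h e k p where "h = hs m" and "e = eps m" and "k = q m" and "p = measure coins (cyl m b)"
  have h: "h > 0" and e: "0 < e" "e \<le> 1 / 2" and p: "p > 0" and k: "0 < k" "k \<le> 1" and ek: "e = k ^ 4"
    using eps_bounds[of m] by (simp_all add: h_def e_def p_def k_def hs_pos measure_cyl_pos q_pos q_le_1 q_pow_4)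
  have "0 < h * k\<^sup>2" using h k by simp
  then have r: "h * (1 + k\<^sup>2) \<le> r" "r \<le> 2 * h" "h < r"
    using large le unfolding h_def k_def distrib_left by linarith+
  then have r0: "r > 0" using h by simp
  define c where "c = fun_upd b m False"
  have P: "measure coins (cyl (Suc m) c) = p * (1 - e)" "measure coins (cyl (Suc m) b) = p * e"
    using \<open>b m\<close> by (simp_all add: measure_cyl_Suc c_def p_def e_def)
  have "ennreal ((2 * h * k) * measure coins (cyl (Suc m) c)) \<le> emeasure mu (ball x r)"
  proof (rule emeasure_mu_ball_ge)
    fix \<omega> assume "\<omega> \<in> cyl (Suc m) c"
    then have "\<omega> \<in> cyl m b" "\<omega> m \<noteq> b m" using cyl_SucD[of \<omega> m c] \<open>b m\<close> by (auto simp: c_def)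
    from Y_first_diff(2)[OF this] have *: "\<bar>Y \<omega> - Y b\<bar> \<le> h * (1 + e / 8)"
      using two_hs_Suc[of m] by (simp add: h_def e_def algebra_simps)
    show "2 * h * k \<le> 2 * sqrt (r\<^sup>2 - (Y \<omega> - x $ 2)\<^sup>2)"
      unfolding y
    proof (rule chord_ge[OF *])
      \<comment> \<open>With \<open>j\<close> the square root of \<open>e\<close>, the radius is at
        least \<open>h * (1 + j)\<close> and the distance at most \<open>h * (1 + j / 8)\<close>;
        the difference of the squares is at least \<open>h\<^sup>2 * j\<close>, the square of half
        the claimed chord.\<close>
      define j where "j = k\<^sup>2"
      have j: "0 < j" "j \<le> 1" "e = j * j"
        using k power_le_one[of k 2] by (simp_all add: j_def ek flip: power_add)
      have "e \<le> j" using j mult_left_mono[of j 1 j] by simp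
      then have "(1 + e / 8)\<^sup>2 \<le> (1 + j / 8)\<^sup>2" using e by (intro power_mono) auto
      also have "(1 + j / 8)\<^sup>2 \<le> (1 + j)\<^sup>2 - j"
      proof -
        have "(1 + j)\<^sup>2 - j - (1 + j / 8)\<^sup>2 = 3 / 4 * j + 63 / 64 * (j * j)"
          by (simp add: power2_eq_square field_simps)
        moreover have "0 \<le> j * j" by simp
        ultimately show ?thesis using j(1) by linarith
      qed
      finally have "j + (1 + e / 8)\<^sup>2 \<le> (1 + j)\<^sup>2" by simp
      then have "h\<^sup>2 * (j + (1 + e / 8)\<^sup>2) \<le> h\<^sup>2 * (1 + j)\<^sup>2" by (intro mult_left_mono) auto
      also have "\<dots> = (h * (1 + j))\<^sup>2" by (simp add: power_mult_distrib)
      also have "\<dots> \<le> r\<^sup>2" using r(1) h j by (intro power_mono) (auto simp: j_def)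
      finally have "h\<^sup>2 * k\<^sup>2 + h\<^sup>2 * (1 + e / 8)\<^sup>2 \<le> r\<^sup>2" by (simp add: j_def distrib_left)
      then show "(2 * h * k)\<^sup>2 \<le> 4 * (r\<^sup>2 - (h * (1 + e / 8))\<^sup>2)"
        unfolding power_mult_distrib by simp
    qed (use h k in auto)
  qed (use h k r0 in auto)
  then have mu_ge: "ennreal ((2 * h * k) * (p * (1 - e))) \<le> emeasure mu (ball x r)" by (simp add: P)
  have mu_pos: "0 < emeasure mu (ball x r)"
    using h k p e by (intro less_le_trans[OF _ mu_ge]) simp
  \<comment> \<open>The model line now carries only the weight of the main part. The side part is
    paid for with the crude bounds \<open>r\<close> for test functions and \<open>2 * r\<close> for
    chords.\<close>
  have "flat_dist (ball x r) mu (flat_measure (measure coins (cyl (Suc m) c)) (hline (Y c)))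
      \<le> ennreal (2 * r * (h * e / 8) * measure coins (cyl (Suc m) c) + 2 * r * r * measure coins (cyl (Suc m) b))"
  proof (rule order_trans[OF flat_dist_mu_le[OF r0 cyl_sets]], rule nn_integral_le_two_sets)
    fix \<omega>
    show "(if \<omega> \<in> cyl (Suc m) c then ennreal (2 * r * \<bar>Y \<omega> - Y c\<bar>)
          else ennreal (r - \<bar>Y \<omega> - x $ 2\<bar>) * ennreal (2 * sqrt (r\<^sup>2 - (Y \<omega> - x $ 2)\<^sup>2)))
        \<le> ennreal (2 * r * (h * e / 8)) * indicator (cyl (Suc m) c) \<omega>
          + ennreal (2 * r * r) * indicator (cyl (Suc m) b) \<omega>"
    proof (cases "\<omega> \<in> cyl (Suc m) c")
      case True
      have "2 * r * \<bar>Y \<omega> - Y c\<bar> \<le> 2 * r * (h * e / 8)"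
        using Y_cyl_dist[OF True] r0 two_hs_Suc[of m] by (intro mult_left_mono) (simp_all add: h_def e_def mult.commute)
      then show ?thesis using True by (auto intro!: ennreal_leI add_increasing2)
    next
      case outside: False
      show ?thesis
      proof (cases "\<omega> \<in> cyl m b")
        case False
        then have "r - \<bar>Y \<omega> - x $ 2\<bar> \<le> 0" using far_outside_cyl[OF near] y by simp
        then show ?thesis using outside by (simp add: ennreal_neg)
      next
        case True
        have "\<omega> m" using outside cyl_SucI[OF True] by (cases "\<omega> m") (auto simp: c_def)
        then have "\<omega> \<in> cyl (Suc m) b"
          using cyl_SucI[OF True] \<open>b m\<close> by (simp add: fun_upd_idem)
        moreover
        have "sqrt (r\<^sup>2 - (Y \<omega> - x $ 2)\<^sup>2) \<le> sqrt (r\<^sup>2)" by (rule real_sqrt_le_mono) simp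
        then have "2 * sqrt (r\<^sup>2 - (Y \<omega> - x $ 2)\<^sup>2) \<le> 2 * r" using r0 by simp
        from mult_mono[OF ennreal_leI ennreal_leI[OF this], of "r - \<bar>Y \<omega> - x $ 2\<bar>" r]
        have "ennreal (r - \<bar>Y \<omega> - x $ 2\<bar>) * ennreal (2 * sqrt (r\<^sup>2 - (Y \<omega> - x $ 2)\<^sup>2))
            \<le> ennreal r * ennreal (2 * r)"
          by simp
        then have "ennreal (r - \<bar>Y \<omega> - x $ 2\<bar>) * ennreal (2 * sqrt (r\<^sup>2 - (Y \<omega> - x $ 2)\<^sup>2))
            \<le> ennreal (2 * r * r)"
          using r0 by (simp add: mult.commute flip: ennreal_mult)
        ultimately show ?thesis using outside by simp
      qed
    qed
  qed (use r0 h e in auto)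
  also have "\<dots> \<le> ennreal (5 * r * k ^ 3 * ((2 * h * k) * (p * (1 - e))))"
  proof (rule ennreal_leI)
    \<comment> \<open>Trading one factor \<open>r\<close> for \<open>2 * h\<close> lets the quotient
      by the chord \<open>2 * h * k\<close> produce \<open>e / k = k ^ 3\<close>.\<close>
    have "2 * r * r \<le> 2 * r * (2 * h)" using r r0 by (intro mult_left_mono) auto
    then have "2 * r * r * (p * e) \<le> 2 * r * (2 * h) * (p * e)" using p e by (intro mult_right_mono) auto
    moreover have "(r * p * h * e) * ((1 - e) / 4 + 4) \<le> (r * p * h * e) * (10 * (1 - e))"
      using r0 h e p by (intro mult_left_mono) auto
    ultimately have "2 * r * (h * e / 8) * (p * (1 - e)) + 2 * r * r * (p * e) \<le> 10 * r * e * h * (p * (1 - e))"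
      by (simp add: algebra_simps)
    also have "\<dots> = 5 * r * k ^ 3 * ((2 * h * k) * (p * (1 - e)))"
      unfolding ek by (simp add: power_numeral_reduce)
    finally show "2 * r * (h * e / 8) * measure coins (cyl (Suc m) c) + 2 * r * r * measure coins (cyl (Suc m) b)
        \<le> 5 * r * k ^ 3 * ((2 * h * k) * (p * (1 - e)))"
      unfolding P .
  qed
  also have "\<dots> = ennreal (5 * r * k ^ 3) * ennreal ((2 * h * k) * (p * (1 - e)))"
    using h e r0 p k by (intro ennreal_mult) auto
  also have "\<dots> \<le> ennreal (5 * r * k ^ 3) * emeasure mu (ball x r)"
    by (intro mult_left_mono mu_ge) auto
  finally have "alpha1 mu x r \<le> ennreal (5 * r * k ^ 3 / r)"
    using r0 k mu_pos
    by (intro alpha1_le[OF r0 _ hline_in_lines]) (auto intro: emeasure_mu_bounded_finite[simplified])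
  then show ?thesis using r0 by (simp add: k_def)
qed

section \<open>Integration over scales and summation over levels\<close>

definition alpha_bound :: "nat \<Rightarrow> real \<Rightarrow> ennreal" where
  "alpha_bound m r =
     ennreal (81 * (hs m)\<^sup>2 * q m ^ 8 / r ^ 3) * indicator {sep m..} r
   + ennreal (4 * q m ^ 4 / sep m) * indicator {sep m..hs m * (1 + (q m)\<^sup>2)} r
   + ennreal (25 * q m ^ 6 / hs m) * indicator {hs m..2 * hs m} r"

lemma alpha_bound_measurable [measurable]: "alpha_bound m \<in> borel_measurable borel"
  unfolding alpha_bound_def[abs_def] by measurable

lemma alpha1_sq_le:
  assumes "a \<le> ennreal t" "0 \<le> t" "0 < r"
  shows "a\<^sup>2 / ennreal r \<le> ennreal (t\<^sup>2 / r)"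
proof -
  have "a\<^sup>2 \<le> (ennreal t)\<^sup>2" using assms(1) by (intro power_mono) auto
  also have "\<dots> = ennreal (t\<^sup>2)" using assms(2) by (simp add: ennreal_power)
  finally have "a\<^sup>2 / ennreal r \<le> ennreal (t\<^sup>2) / ennreal r" by (rule divide_right_mono_ennreal)
  then show ?thesis using assms by (simp add: divide_ennreal)
qed

text \<open>The three terms of \<open>alpha_bound\<close> are the squares of the three estimates
  divided by \<open>r\<close>; in the last two, \<open>r\<close> in the denominator is replaced by
  the left endpoint of an interval containing the scales in question.\<close>

lemma alpha1_le_bound:
  assumes y: "x $ 2 = Y b" and near: "m = 0 \<or> r \<le> sep (m - 1)" and sep: "sep m \<le> r"
  shows "(alpha1 mu x r)\<^sup>2 / ennreal r \<le> alpha_bound m r"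
proof -
  have r: "r > 0" using sep sep_bounds[of m] by linarith
  have hm: "hs m \<le> hs m * (1 + (q m)\<^sup>2)" using hs_pos[of m] by (simp add: algebra_simps)
  consider "\<not> b m \<or> 2 * hs m \<le> r" | "r \<le> hs m * (1 + (q m)\<^sup>2)"
    | "b m" "hs m * (1 + (q m)\<^sup>2) \<le> r" "r \<le> 2 * hs m"
    by linarith
  then show ?thesis
  proof cases
    case 1
    have "(alpha1 mu x r)\<^sup>2 / ennreal r \<le> ennreal ((9 * hs m * eps m / r)\<^sup>2 / r)"
      using hs_pos[of m] eps_bounds[of m] r by (intro alpha1_sq_le alpha1_main[OF y near sep 1]) auto
    also have "(9 * hs m * eps m / r)\<^sup>2 / r = 81 * (hs m)\<^sup>2 * q m ^ 8 / r ^ 3"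
      unfolding q_pow_4[symmetric] by (simp add: power_mult_distrib power_divide power_numeral_reduce mult_ac)
    also have "ennreal \<dots> \<le> alpha_bound m r"
      unfolding alpha_bound_def using sep by (simp add: add_increasing2 add.assoc)
    finally show ?thesis .
  next
    case 2
    have "(alpha1 mu x r)\<^sup>2 / ennreal r \<le> ennreal ((2 * (q m)\<^sup>2)\<^sup>2 / r)"
      using r by (intro alpha1_sq_le alpha1_side_small[OF y sep 2]) auto
    also have "\<dots> \<le> ennreal (4 * q m ^ 4 / sep m)"
      using sep sep_bounds(3)[of m] by (intro ennreal_leI) (auto simp: power_mult_distrib intro!: divide_left_mono)
    also have "\<dots> \<le> alpha_bound m r"
      unfolding alpha_bound_def using sep 2 by (simp add: add_increasing add_increasing2)
    finally show ?thesis .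
  next
    case 3
    have hr: "hs m \<le> r" using hm 3(2) by linarith
    have "(alpha1 mu x r)\<^sup>2 / ennreal r \<le> ennreal ((5 * q m ^ 3)\<^sup>2 / r)"
      using r q_pos[of m] by (intro alpha1_sq_le alpha1_side_large[OF y near 3]) auto
    also have "\<dots> \<le> ennreal (25 * q m ^ 6 / hs m)"
      using hr hs_pos[of m] r by (intro ennreal_leI) (auto simp: power_mult_distrib intro!: divide_left_mono)
    also have "\<dots> \<le> alpha_bound m r"
      unfolding alpha_bound_def using 3 hr by (simp add: add_increasing)
    finally show ?thesis .
  qed
qed

lemma nn_integral_inverse_cube:
  fixes a :: real
  assumes "a > 0" "K \<ge> 0"
  shows "(\<integral>\<^sup>+r. ennreal (K / r ^ 3) * indicator {a..} r \<partial>lborel) = ennreal (K / (2 * a\<^sup>2))"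
proof -
  have "(\<integral>\<^sup>+r. ennreal (K / r ^ 3) * indicator {a..} r \<partial>lborel) = ennreal (0 - (- K / (2 * a\<^sup>2)))"
  proof (rule nn_integral_FTC_atLeast)
    show "(\<lambda>r. K / r ^ 3) \<in> borel_measurable borel" by measurable
    fix r assume r: "a \<le> r"
    then show "0 \<le> K / r ^ 3" using assms by simp
    show "((\<lambda>r. - K / (2 * r\<^sup>2)) has_real_derivative K / r ^ 3) (at r)"
      using r assms by (auto intro!: derivative_eq_intros simp: power_numeral_reduce field_simps)
  next
    show "((\<lambda>r. - K / (2 * r\<^sup>2)) \<longlongrightarrow> 0) at_top"
      by (intro tendsto_divide_0[OF tendsto_const] filterlim_at_top_imp_at_infinity
          filterlim_tendsto_pos_mult_at_top[OF tendsto_const] filterlim_pow_at_top filterlim_ident) auto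
  qed
  then show ?thesis by simp
qed

text \<open>The terms contribute at most 50, 5 and 25 times \<open>q m ^ 6\<close>. The second has
  height of order \<open>q m ^ 4 / hs m\<close>, but its interval, the transition, has length only
  of order \<open>hs m * (q m)\<^sup>2\<close>.\<close>

lemma nn_integral_alpha_bound: "(\<integral>\<^sup>+r. alpha_bound m r \<partial>lborel) \<le> ennreal (80 * q m ^ 6)"
proof -
  define h k s where "h = hs m" and "k = q m" and "s = sep m"
  have h: "h > 0" and k: "0 < k" "k \<le> 1" and s: "15 / 16 * h \<le> s" "s < h" "0 < s"
    using hs_pos[of m] q_pos[of m] q_le_1[of m] sep_bounds[of m] by (simp_all only: h_def k_def s_def)
  have s2: "s = h - h * k ^ 4 / 8" by (simp add: h_def k_def s_def sep_eq q_pow_4)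
  have "(\<integral>\<^sup>+r. alpha_bound m r \<partial>lborel)
      = (\<integral>\<^sup>+r. ennreal (81 * h\<^sup>2 * k ^ 8 / r ^ 3) * indicator {s..} r \<partial>lborel)
        + ennreal (4 * k ^ 4 / s) * emeasure lborel {s..h * (1 + k\<^sup>2)}
        + ennreal (25 * k ^ 6 / h) * emeasure lborel {h..2 * h}"
    unfolding alpha_bound_def h_def[symmetric] k_def[symmetric] s_def[symmetric]
    by (subst nn_integral_add, measurable)+ (simp add: nn_integral_cmult_indicator)
  also have "\<dots> = ennreal (81 * h\<^sup>2 * k ^ 8 / (2 * s\<^sup>2)) + ennreal (4 * k ^ 4 / s * (h * (1 + k\<^sup>2) - s)) + ennreal (25 * k ^ 6 / h * h)"
  proof -
    have "s \<le> h * (1 + k\<^sup>2)" using s h by (simp add: algebra_simps add_increasing2)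
    then show ?thesis
      using s h k by (subst nn_integral_inverse_cube) (auto simp: ennreal_mult[symmetric])
  qed
  also have "\<dots> = ennreal (81 * h\<^sup>2 * k ^ 8 / (2 * s\<^sup>2) + 4 * k ^ 4 / s * (h * (1 + k\<^sup>2) - s) + 25 * k ^ 6 / h * h)"
  proof -
    have "0 \<le> h * (1 + k\<^sup>2) - s" using s h by (simp add: algebra_simps add_increasing2)
    then show ?thesis using s h k by (simp flip: ennreal_plus)
  qed
  also have "\<dots> \<le> ennreal (80 * k ^ 6)"
  proof (rule ennreal_leI)
    have k6: "k ^ 8 \<le> k ^ 6" using k by (intro power_decreasing) auto
    have "(15 / 16 * h)\<^sup>2 \<le> s\<^sup>2" using s h by (intro power_mono) auto
    then have "225 * h\<^sup>2 \<le> 256 * s\<^sup>2" by (simp add: power_mult_distrib power_divide)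
    then have "81 * h\<^sup>2 \<le> 50 * (2 * s\<^sup>2)" using zero_le_power2[of h] by linarith
    then have "81 * h\<^sup>2 * k ^ 8 \<le> 50 * (2 * s\<^sup>2) * k ^ 6"
      using k k6 by (intro mult_mono[of "81 * h\<^sup>2"]) auto
    then have 1: "81 * h\<^sup>2 * k ^ 8 / (2 * s\<^sup>2) \<le> 50 * k ^ 6"
      using s by (simp add: pos_divide_le_eq algebra_simps)
    have "k ^ 4 \<le> k\<^sup>2" using k by (intro power_decreasing) auto
    then have "h * k ^ 4 \<le> h * k\<^sup>2" using h by simp
    then have "h * (1 + k\<^sup>2) - s \<le> 9 / 8 * (h * k\<^sup>2)" unfolding s2 by (simp add: algebra_simps)
    also have "\<dots> \<le> 5 / 4 * k\<^sup>2 * s"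
    proof -
      have "15 / 16 * (h * k\<^sup>2) \<le> k\<^sup>2 * s" using mult_left_mono[OF s(1), of "k\<^sup>2"] by (simp add: mult_ac)
      moreover have "0 \<le> h * k\<^sup>2" using h by simp
      ultimately show ?thesis by linarith
    qed
    finally have "4 * k ^ 4 / s * (h * (1 + k\<^sup>2) - s) \<le> 4 * k ^ 4 / s * (5 / 4 * k\<^sup>2 * s)"
      using s k by (intro mult_left_mono) auto
    also have "\<dots> = 5 * k ^ 6" using s by (simp add: power_numeral_reduce)
    finally show "81 * h\<^sup>2 * k ^ 8 / (2 * s\<^sup>2) + 4 * k ^ 4 / s * (h * (1 + k\<^sup>2) - s) + 25 * k ^ 6 / h * h \<le> 80 * k ^ 6"
      using 1 h by simp
  qed
  finally show ?thesis by (simp add: k_def)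
qed

lemma alpha1_square_integral_finite:
  assumes "x \<in> measure_support mu"
  shows "(\<integral>\<^sup>+r\<in>{0<..<1}. (alpha1 mu x r)\<^sup>2 / ennreal r \<partial>lborel) < \<infinity>"
proof -
  obtain b where y: "x $ 2 = Y b" using measure_support_mu[OF assms] by blast
  have "(\<integral>\<^sup>+r\<in>{0<..<1}. (alpha1 mu x r)\<^sup>2 / ennreal r \<partial>lborel)
      \<le> (\<integral>\<^sup>+r. (\<Sum>m. alpha_bound m r) \<partial>lborel)"
  proof (rule nn_integral_mono)
    fix r :: real
    show "(alpha1 mu x r)\<^sup>2 / ennreal r * indicator {0<..<1} r \<le> (\<Sum>m. alpha_bound m r)"
    proof (cases "r \<in> {0<..<1}")
      case True
      then have "eventually (\<lambda>n. hs n < r) sequentially"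
        using hs_tendsto_0 by (intro order_tendstoD) auto
      then obtain n where "hs n < r" by (auto simp: eventually_sequentially)
      then have n: "sep n \<le> r" using sep_bounds(2)[of n] by simp
      \<comment> \<open>Each scale is handled at the first level whose separation it reaches, so
        \<open>r\<close> lies between \<open>sep m\<close> and \<open>sep (m - 1)\<close>. Summing
        all levels then avoids a partition of the scales.\<close>
      define m where "m = (LEAST m. sep m \<le> r)"
      have m: "sep m \<le> r" unfolding m_def by (rule LeastI[of _ n]) (rule n)
      have "m = 0 \<or> r \<le> sep (m - 1)"
      proof (cases m)
        case (Suc k)
        then have "\<not> sep k \<le> r" unfolding m_def by (intro not_less_Least) simp
        then show ?thesis using Suc by simp
      qed simp
      then have "(alpha1 mu x r)\<^sup>2 / ennreal r \<le> alpha_bound m r"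
        using m by (rule alpha1_le_bound[OF y])
      also have "\<dots> \<le> (\<Sum>m. alpha_bound m r)"
        using sum_le_suminf[of "\<lambda>m. alpha_bound m r" "{m}"] by simp
      finally show ?thesis using True by simp
    qed simp
  qed
  also have "\<dots> = (\<Sum>m. \<integral>\<^sup>+r. alpha_bound m r \<partial>lborel)"
    by (rule nn_integral_suminf) simp
  also have "\<dots> \<le> (\<Sum>m. ennreal (80 * q m ^ 6))"
    by (intro suminf_le nn_integral_alpha_bound) auto
  also have "\<dots> = ennreal (\<Sum>m. 80 * q m ^ 6)"
    using q_pos by (intro suminf_ennreal2 summable_mult summable_q_pow_6) (auto simp: less_imp_le)
  also have "\<dots> < \<infinity>" by simp
  finally show ?thesis .
qed

theorem theorem2:
  shows "\<exists>\<mu> :: (real^2) measure.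
    radon_measure \<mu> \<and>
    (\<forall>x\<in>measure_support \<mu>.
       (\<integral>\<^sup>+r\<in>{0<..<1}. (alpha1 \<mu> x r)\<^sup>2 / ennreal r \<partial>lborel) < \<infinity>) \<and>
    (\<forall>x\<in>measure_support \<mu>.
       ((\<lambda>r. measure \<mu> (ball x r) / r) \<longlongrightarrow> 0) (at_right 0)) \<and>
    \<not> rectifiable1 \<mu>"
  using radon_mu alpha1_square_integral_finite mu_density_tendsto_0 not_rectifiable_mu by blast

end
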